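(* Let $n\ge 2$ and let $\boldsymbol\mu=(\mu_1,\dots,\mu_n)\in\mathcal M^n$ be a bandit instance of the exponential family described in the context with $\mu_1>\mu_2\ge\dots\ge\mu_n$. Fix $\alpha\in(1,e/2]$. For $\delta\in(0,e^{-e})$ run the Tri-BBAI algorithm with parameters $\epsilon=\frac{1}{\log\log(1/\delta)}$, $L_1=\sqrt{\log(1/\delta)}$, $L_2=\frac{\log(1/\delta)\,\log\log(1/\delta)}{n}$, $L_3=(\log(1/\delta))^2$, the given $\alpha$, and threshold function $\beta(t,\delta)=\log\!\big(\log(1/\delta)\,t^{\alpha}/\delta\big)$, and let $N_\delta$ be its total number of arm pulls. Then $$\limsup_{\delta\to0}\frac{\mathbb E_{\boldsymbol\mu}[N_\delta]}{\log(1/\delta)}\le \alpha\,T^*(\boldsymbol\mu).$$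
   Context: Bandit model. Fix a one-parameter canonical exponential family $\{\nu_\theta\}_{\theta\in\Theta}$ ($\Theta$ an open interval): $\frac{d\nu_\theta}{d\rho}(x)=\exp(x\theta-b(\theta))$ for a reference measure $\rho$ on $\mathbb R$, with $b(\theta)=\log\int e^{x\theta}d\rho(x)$. The mean map $\theta\mapsto b'(\theta)$ is a bijection from $\Theta$ onto an open interval $\mathcal M$, so members of the family are indexed by their mean. For $\mu,\mu'\in\mathcal M$, $d(\mu,\mu')$ denotes the Kullback–Leibler divergence from the member with mean $\mu$ to the member with mean $\mu'$. An instance is $\boldsymbol\mu\in\mathcal M^n$; pulling arm $i$ yields a fresh independent sample from the member with mean $\mu_i$. All logarithms are natural. Characteristic time. For $\boldsymbol\lambda\in\mathcal M^n$ and an index $k$ with $\lambda_k>\lambda_j$ for all $j\ne k$, let $\mathrm{Alt}_k(\boldsymbol\lambda)=\{\boldsymbol\lambda'\in\mathcal M^n:\lambda'_j>\lambda'_k\text{ for some }j\neq k\}$, $\mathcal P_n$ the probability simplex in $\mathbb R^n$, and $T^*(\boldsymbol\lambda)^{-1}=\sup_{\mathbf w\in\mathcal P_n}\inf_{\boldsymbol\lambda'\in\mathrm{Alt}_k(\boldsymbol\lambda)}\sum_{i=1}^n w_i\,d(\lambda_i,\lambda'_i)$, with $\mathbf w^*(\boldsymbol\lambda)\in\mathcal P_n$ the (unique) maximizer. For the instance, $T^*(\boldsymbol\mu)$ is taken with $k=1$. Notation during a run. After $t$ total pulls, $N_i(t)$ is the number of pulls of arm $i$, $\hat\mu_i(t)$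 the empirical mean of its samples, $i^*(t)\in\arg\max_i\hat\mu_i(t)$ (ties broken by smallest index). For arms $i,j$: $\hat\mu_{ij}(t)=\frac{N_i(t)\hat\mu_i(t)+N_j(t)\hat\mu_j(t)}{N_i(t)+N_j(t)}$; if $\hat\mu_i(t)\ge\hat\mu_j(t)$, $Z_{ij}(t)=N_i(t)\,d(\hat\mu_i(t),\hat\mu_{ij}(t))+N_j(t)\,d(\hat\mu_j(t),\hat\mu_{ij}(t))$, and $Z_j(t)=Z_{i^*(t)j}(t)$. Tri-BBAI algorithm (parameters $\delta,\epsilon,L_1,L_2,L_3,\alpha,\beta$). Stage I (one batch): pull every arm $\lceil L_1\rceil$ times; set $T_i^0=L_1$ for all $i$ and $\mathbf w^*(\mathbf b^0)=(1/n,\dots,1/n)$. Stage II: for $q=1,2,\dots,\lceil\log(1/\delta)\rceil$, with $t$ the current total number of pulls, set $b^q_i=\hat\mu_i(t)+\epsilon$ for $i\ne i^*(t)$ and $b^q_{i^*(t)}=\hat\mu_{i^*(t)}(t)-\epsilon$; compute $\mathbf w^*(\mathbf b^q)$ and $T^*(\mathbf b^q)$ with designated index $k=i^*(t)$ (convention: if $\mathbf b^q\notin\mathcal M^n$ or $i^*(t)$ is not the unique maximal coordinate of $\mathbf b^q$, set $\mathbf w^*(\mathbf b^q)$ uniform and $T^*(\mathbf b^q)=+\infty$); let $T_i^q=\min\{\alpha\,w_i^*(\mathbf b^q)T^*(\mathbf b^q)\log(1/\delta),\,L_2\}$; in one batch pull each arm $i$ exactly $\max\{0,\lceil T_i^q\rceil-\lceil\max_{0\le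 p<q}T_i^p\rceil\}$ times; then if $|w_i^*(\mathbf b^q)-w_i^*(\mathbf b^{q-1})|\le 1/\sqrt n$ for all $i\in[n]$, leave Stage II. Stage III: let $\tau$ be the current total number of pulls; if $\min_{j\ne i^*(\tau)}Z_j(\tau)\ge\beta(\tau,\delta/2)$, stop and output $i^*(\tau)$. Stage IV (one batch, only if Stage III did not stop): pull each arm $i$ an additional $\max\{0,\lceil L_3\rceil-N_i(\tau)\}$ times and output the arm with largest empirical mean. The batch complexity is the number of batches used (Stage I, each executed iteration of Stage II, and Stage IV if executed). *)

theory Defs
  imports "HOL-Probability.Probability"
begin

definition logpart :: "real measure \<Rightarrow> real \<Rightarrow> real" where
  "logpart \<rho> \<theta> = ln (\<integral>x. exp (x * \<theta>) \<partial>\<rho>)"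

definition expfam :: "real measure \<Rightarrow> real set \<Rightarrow> bool" where
  "expfam \<rho> \<Theta> \<longleftrightarrow>
     sets \<rho> = sets borel \<and>
     \<Theta> \<noteq> {} \<and> open \<Theta> \<and> is_interval \<Theta> \<and>
     (\<forall>\<theta>\<in>\<Theta>. integrable \<rho> (\<lambda>x. exp (x * \<theta>)) \<and> (\<integral>x. exp (x * \<theta>) \<partial>\<rho>) > 0) \<and>
     (\<forall>\<theta>\<in>\<Theta>. logpart \<rho> differentiable (at \<theta>)) \<and>
     inj_on (deriv (logpart \<rho>)) \<Theta> \<and>
     open (deriv (logpart \<rho>) ` \<Theta>) \<and> is_interval (deriv (logpart \<rho>) ` \<Theta>)"

definition meanset :: "real measure \<Rightarrow> real set \<Rightarrow> real set" where
  "meanset \<rho> \<Theta> = deriv (logpart \<rho>) ` \<Theta>"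

definition theta_of :: "real measure \<Rightarrow> real set \<Rightarrow> real \<Rightarrow> real" where
  "theta_of \<rho> \<Theta> \<mu> = (THE \<theta>. \<theta> \<in> \<Theta> \<and> deriv (logpart \<rho>) \<theta> = \<mu>)"

definition member :: "real measure \<Rightarrow> real set \<Rightarrow> real \<Rightarrow> real measure" where
  "member \<rho> \<Theta> \<mu> =
     density \<rho> (\<lambda>x. ennreal (exp (x * theta_of \<rho> \<Theta> \<mu> - logpart \<rho> (theta_of \<rho> \<Theta> \<mu>))))"

text \<open>d(mu, mu'): KL divergence from the member with mean mu to the member with mean mu'.
  Note: the library's KL_divergence b M N is KL(N || M).\<close>
definition kl :: "real measure \<Rightarrow> real set \<Rightarrow> real \<Rightarrow> real \<Rightarrow> real" where
  "kl \<rho> \<Theta> \<mu> \<mu>' = KL_divergence (exp 1) (member \<rho> \<Theta> \<mu>') (member \<rho> \<Theta> \<mu>)"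

text \<open>d extended to arbitrary real arguments (needed for empirical means, which may
  lie on the boundary of M): equal to d on M x M; otherwise the Cramer rate
  function sup over theta of ((theta - theta_y) x - b(theta) + b(theta_y)) when y is in M
  (which agrees with d on M), and 0 / infinity when y is not in M.\<close>
definition klext :: "real measure \<Rightarrow> real set \<Rightarrow> real \<Rightarrow> real \<Rightarrow> ereal" where
  "klext \<rho> \<Theta> x y =
     (if x \<in> meanset \<rho> \<Theta> \<and> y \<in> meanset \<rho> \<Theta> then ereal (kl \<rho> \<Theta> x y)
      else if y \<in> meanset \<rho> \<Theta> then
        (SUP \<theta>\<in>\<Theta>. ereal ((\<theta> - theta_of \<rho> \<Theta> y) * x - logpart \<rho> \<theta>
                              + logpart \<rho> (theta_of \<rho> \<Theta> y)))
      else if x = y then 0 else \<infinity>)"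

section \<open>Characteristic time (arms are indexed 0..n-1)\<close>

definition prob_simplex :: "nat \<Rightarrow> (nat \<Rightarrow> real) set" where
  "prob_simplex n = {w. (\<forall>i<n. 0 \<le> w i) \<and> (\<Sum>i<n. w i) = 1}"

definition Alt :: "real measure \<Rightarrow> real set \<Rightarrow> nat \<Rightarrow> nat \<Rightarrow> (nat \<Rightarrow> real) set" where
  "Alt \<rho> \<Theta> n k = {lam'. (\<forall>i<n. lam' i \<in> meanset \<rho> \<Theta>) \<and> (\<exists>j<n. j \<noteq> k \<and> lam' j > lam' k)}"

definition charval :: "real measure \<Rightarrow> real set \<Rightarrow> nat \<Rightarrow> nat \<Rightarrow> (nat \<Rightarrow> real) \<Rightarrow> (nat \<Rightarrow> real) \<Rightarrow> real" where
  "charval \<rho> \<Theta> n k lam w = (INF lam'\<in>Alt \<rho> \<Theta> n k. \<Sum>i<n. w i * kl \<rho> \<Theta> (lam i) (lam' i))"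

definition Tstar_inv :: "real measure \<Rightarrow> real set \<Rightarrow> nat \<Rightarrow> nat \<Rightarrow> (nat \<Rightarrow> real) \<Rightarrow> real" where
  "Tstar_inv \<rho> \<Theta> n k lam = (SUP w\<in>prob_simplex n. charval \<rho> \<Theta> n k lam w)"

definition Tstar :: "real measure \<Rightarrow> real set \<Rightarrow> nat \<Rightarrow> nat \<Rightarrow> (nat \<Rightarrow> real) \<Rightarrow> real" where
  "Tstar \<rho> \<Theta> n k lam = 1 / Tstar_inv \<rho> \<Theta> n k lam"

text \<open>The (unique) maximiser w*(lambda).\<close>
definition wstar :: "real measure \<Rightarrow> real set \<Rightarrow> nat \<Rightarrow> nat \<Rightarrow> (nat \<Rightarrow> real) \<Rightarrow> (nat \<Rightarrow> real)" where
  "wstar \<rho> \<Theta> n k lam =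
     (SOME w. w \<in> prob_simplex n \<and> charval \<rho> \<Theta> n k lam w = Tstar_inv \<rho> \<Theta> n k lam)"

definition valid_inst :: "real measure \<Rightarrow> real set \<Rightarrow> nat \<Rightarrow> nat \<Rightarrow> (nat \<Rightarrow> real) \<Rightarrow> bool" where
  "valid_inst \<rho> \<Theta> n k lam \<longleftrightarrow>
     (\<forall>i<n. lam i \<in> meanset \<rho> \<Theta>) \<and> k < n \<and> (\<forall>j<n. j \<noteq> k \<longrightarrow> lam j < lam k)"

text \<open>Sample model: X (i, s) is the s-th sample (s = 0,1,...) obtained from arm i.
  A pull count vector N means arm i has received samples X(i,0..N i - 1).\<close>

definition empmean :: "(nat \<times> nat \<Rightarrow> real) \<Rightarrow> (nat \<Rightarrow> nat) \<Rightarrow> nat \<Rightarrow> real" where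
  "empmean X N i = (\<Sum>s<N i. X (i, s)) / real (N i)"

definition empbest :: "nat \<Rightarrow> (nat \<times> nat \<Rightarrow> real) \<Rightarrow> (nat \<Rightarrow> nat) \<Rightarrow> nat" where
  "empbest n X N = (LEAST i. i < n \<and> (\<forall>j<n. empmean X N j \<le> empmean X N i))"

definition Zstat :: "real measure \<Rightarrow> real set \<Rightarrow> (nat \<times> nat \<Rightarrow> real) \<Rightarrow> (nat \<Rightarrow> nat) \<Rightarrow> nat \<Rightarrow> nat \<Rightarrow> ereal" where
  "Zstat \<rho> \<Theta> X N i j =
     (let mi = empmean X N i; mj = empmean X N j;
          mij = (real (N i) * mi + real (N j) * mj) / real (N i + N j)
      in ereal (real (N i)) * klext \<rho> \<Theta> mi mij + ereal (real (N j)) * klext \<rho> \<Theta> mj mij)"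

definition bvec :: "nat \<Rightarrow> real \<Rightarrow> (nat \<times> nat \<Rightarrow> real) \<Rightarrow> (nat \<Rightarrow> nat) \<Rightarrow> nat \<Rightarrow> real" where
  "bvec n \<epsilon> X N i =
     (if i = empbest n X N then empmean X N i - \<epsilon> else empmean X N i + \<epsilon>)"

definition wconv :: "real measure \<Rightarrow> real set \<Rightarrow> nat \<Rightarrow> nat \<Rightarrow> (nat \<Rightarrow> real) \<Rightarrow> (nat \<Rightarrow> real)" where
  "wconv \<rho> \<Theta> n k lam =
     (if valid_inst \<rho> \<Theta> n k lam then wstar \<rho> \<Theta> n k lam else (\<lambda>_. 1 / real n))"

text \<open>T_i^q = min(alpha w_i* T* log(1/delta), L2); with the convention T* = +infinity
  (and w* uniform, so w_i* > 0) this is L2.\<close>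
definition Tq :: "real measure \<Rightarrow> real set \<Rightarrow> nat \<Rightarrow> real \<Rightarrow> real \<Rightarrow> real \<Rightarrow> nat \<Rightarrow> (nat \<Rightarrow> real) \<Rightarrow> nat \<Rightarrow> real" where
  "Tq \<rho> \<Theta> n \<delta> L2 \<alpha> k lam i =
     (if valid_inst \<rho> \<Theta> n k lam
      then min (\<alpha> * wstar \<rho> \<Theta> n k lam i * Tstar \<rho> \<Theta> n k lam * ln (1 / \<delta>)) L2
      else L2)"

text \<open>Stage II state after q iterations: (pull counts N, max_{p<q+1} T_i^p, last w*, left-Stage-II flag).
  Iteration 0 is the state after Stage I.\<close>
fun stage2 :: "real measure \<Rightarrow> real set \<Rightarrow> nat \<Rightarrow> real \<Rightarrow> real \<Rightarrow> real \<Rightarrow> real \<Rightarrow> real \<Rightarrow>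
                (nat \<times> nat \<Rightarrow> real) \<Rightarrow> nat \<Rightarrow>
                (nat \<Rightarrow> nat) \<times> (nat \<Rightarrow> real) \<times> (nat \<Rightarrow> real) \<times> bool" where
  "stage2 \<rho> \<Theta> n \<delta> \<epsilon> L1 L2 \<alpha> X 0 =
     ((\<lambda>i. if i < n then nat \<lceil>L1\<rceil> else 0), (\<lambda>_. L1), (\<lambda>_. 1 / real n), False)"
| "stage2 \<rho> \<Theta> n \<delta> \<epsilon> L1 L2 \<alpha> X (Suc q) =
     (let (N, Tm, wp, stop) = stage2 \<rho> \<Theta> n \<delta> \<epsilon> L1 L2 \<alpha> X q in
      if stop then (N, Tm, wp, stop) else
      let k = empbest n X N;
          b = bvec n \<epsilon> X N;
          w = wconv \<rho> \<Theta> n k b;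
          T = Tq \<rho> \<Theta> n \<delta> L2 \<alpha> k b;
          N' = (\<lambda>i. if i < n then N i + nat (\<lceil>T i\<rceil> - \<lceil>Tm i\<rceil>) else 0);
          Tm' = (\<lambda>i. max (Tm i) (T i));
          stop' = (\<forall>i<n. \<bar>w i - wp i\<bar> \<le> 1 / sqrt (real n))
      in (N', Tm', w, stop'))"

definition tribbai_pulls :: "real measure \<Rightarrow> real set \<Rightarrow> nat \<Rightarrow> real \<Rightarrow> real \<Rightarrow> real \<Rightarrow> real \<Rightarrow> real \<Rightarrow>
      real \<Rightarrow> (real \<Rightarrow> real \<Rightarrow> real) \<Rightarrow> (nat \<times> nat \<Rightarrow> real) \<Rightarrow> nat" where
  "tribbai_pulls \<rho> \<Theta> n \<delta> \<epsilon> L1 L2 L3 \<alpha> \<beta> X =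
     (let N = fst (stage2 \<rho> \<Theta> n \<delta> \<epsilon> L1 L2 \<alpha> X (nat \<lceil>ln (1 / \<delta>)\<rceil>));
          \<tau> = (\<Sum>i<n. N i);
          k = empbest n X N
      in if (\<forall>j<n. j \<noteq> k \<longrightarrow> Zstat \<rho> \<Theta> X N k j \<ge> ereal (\<beta> (real \<tau>) (\<delta> / 2)))
         then \<tau>
         else (\<Sum>i<n. max (N i) (nat \<lceil>L3\<rceil>)))"

definition sample_space :: "real measure \<Rightarrow> real set \<Rightarrow> nat \<Rightarrow> (nat \<Rightarrow> real) \<Rightarrow> (nat \<times> nat \<Rightarrow> real) measure" where
  "sample_space \<rho> \<Theta> n \<mu> = PiM ({..<n} \<times> UNIV) (\<lambda>(i, s). member \<rho> \<Theta> (\<mu> i))"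

end

theory Submission
  imports Defs "HOL-Real_Asymp.Real_Asymp"
begin

text \<open>
  Let \<open>L = ln (1 / \<delta>)\<close> and let \<open>c\<^sub>i = w\<^sub>i\<^sup>* T\<^sup>*\<close> be the optimal costs of the instance. The infimum
  over alternatives is a minimum of two-arm costs \<open>G\<close>, from which the optimal allocation exists and
  is unique; being an infimum of continuous functions the objective is upper semicontinuous, so
  uniqueness makes \<open>c\<close> continuous in the instance. By Chernoff's bound, outside an event of
  probability \<open>O(exp (- p sqrt L))\<close> all empirical means formed after Stage I are close to the true
  ones. There every Stage II target is within \<open>\<alpha> \<eta> L\<close> of \<open>\<alpha> c\<^sub>i L\<close>, no matter how many iterations are
  executed, and the statistic of Stage III is close to at least \<open>\<alpha> L\<close>, which exceeds the threshold
  \<open>L + O(ln L)\<close> since \<open>\<alpha> > 1\<close>; hence about \<open>\<alpha> T\<^sup>* L\<close> pulls are used. On the exceptional event the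
  number of pulls is \<open>O(L\<^sup>2)\<close>, which contributes \<open>o(L)\<close> to the expectation. Measurability of the
  number of pulls is never needed, since an upper bound on a lower integral suffices.
\<close>

section \<open>Exponential families\<close>

locale exp_family =
  fixes \<rho> :: "real measure" and \<Theta> :: "real set"
  assumes expfam: "expfam \<rho> \<Theta>"
begin

abbreviation "b \<equiv> logpart \<rho>"
abbreviation "M \<equiv> meanset \<rho> \<Theta>"
abbreviation "th \<equiv> theta_of \<rho> \<Theta>"

text \<open>The member indexed by its natural parameter instead of its mean, so that an exponential
  tilt by \<open>s\<close> is the shift from \<theta> to \<theta> + s.\<close>

definition tilted :: "real \<Rightarrow> real measure" where
  "tilted \<theta> = density \<rho> (\<lambda>x. ennreal (exp (x * \<theta> - b \<theta>)))"

lemma sets_\<rho>[measurable_cong]: "sets \<rho> = sets borel"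
  using expfam by (simp add: expfam_def)

lemma open_\<Theta>: "open \<Theta>"
  and open_M: "open M" and interval_M: "is_interval M"
  and inj_mean: "inj_on (deriv b) \<Theta>"
  using expfam by (simp_all add: expfam_def meanset_def)

lemma M_nonempty: "M \<noteq> {}"
  using expfam by (simp add: expfam_def meanset_def)

lemma convex_M: "convex M"
  using interval_M is_interval_convex_1 by blast

lemma integrable_exp: "\<theta> \<in> \<Theta> \<Longrightarrow> integrable \<rho> (\<lambda>x. exp (x * \<theta>))"
  and partition_pos: "\<theta> \<in> \<Theta> \<Longrightarrow> (\<integral>x. exp (x * \<theta>) \<partial>\<rho>) > 0"
  using expfam by (simp_all add: expfam_def)

lemma DERIV_b: "\<theta> \<in> \<Theta> \<Longrightarrow> (b has_real_derivative deriv b \<theta>) (at \<theta>)"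
  using expfam DERIV_deriv_iff_real_differentiable unfolding expfam_def by blast

section \<open>Moments of the tilted laws and convexity of the log-partition function\<close>

lemma sets_tilted[measurable_cong]: "sets (tilted \<theta>) = sets borel"
  by (simp add: tilted_def sets_\<rho>)

text \<open>Tilting by \<open>exp (s * x)\<close> only changes the natural parameter, so the moment
  generating function is a quotient of two partition functions.\<close>

lemma mgf_tilted:
  assumes "\<theta> \<in> \<Theta>" "\<theta> + s \<in> \<Theta>"
  shows "integrable (tilted \<theta>) (\<lambda>x. exp (s * x))"
    and "(\<integral>x. exp (s * x) \<partial>tilted \<theta>) = exp (b (\<theta> + s) - b \<theta>)"
proof -
  have eq: "exp (x * \<theta> - b \<theta>) * exp (s * x) = exp (- b \<theta>) * exp (x * (\<theta> + s))" for x
    by (simp add: exp_add[symmetric] algebra_simps)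
  show "integrable (tilted \<theta>) (\<lambda>x. exp (s * x))"
    unfolding tilted_def using integrable_exp[OF assms(2)]
    by (subst integrable_real_density) (auto simp: eq)
  have "(\<integral>x. exp (s * x) \<partial>tilted \<theta>) = exp (- b \<theta>) * (\<integral>x. exp (x * (\<theta> + s)) \<partial>\<rho>)"
    unfolding tilted_def by (subst integral_real_density) (auto simp: eq)
  also have "\<dots> = exp (- b \<theta>) * exp (b (\<theta> + s))"
    using partition_pos[OF assms(2)] by (simp add: logpart_def)
  finally show "(\<integral>x. exp (s * x) \<partial>tilted \<theta>) = exp (b (\<theta> + s) - b \<theta>)"
    by (simp add: exp_add[symmetric])
qed

lemma nn_mgf_tilted:
  assumes "\<theta> \<in> \<Theta>" "\<theta> + s \<in> \<Theta>"
  shows "(\<integral>\<^sup>+x. ennreal (exp (s * x)) \<partial>tilted \<theta>) = ennreal (exp (b (\<theta> + s) - b \<theta>))"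
  using mgf_tilted[OF assms] by (subst nn_integral_eq_integral) auto

lemma prob_space_tilted: "\<theta> \<in> \<Theta> \<Longrightarrow> prob_space (tilted \<theta>)"
  \<comment> \<open>At \<open>s = 0\<close> the formula gives the total mass, namely
    \<open>exp 0 = 1\<close>.\<close>
  using nn_mgf_tilted[of \<theta> 0] by (intro prob_spaceI) simp

lemma ball_\<Theta>:
  assumes "\<theta> \<in> \<Theta>"
  obtains e where "e > 0" "\<And>s. \<bar>s\<bar> < e \<Longrightarrow> \<theta> + s \<in> \<Theta>"
proof -
  obtain e where e: "e > 0" "ball \<theta> e \<subseteq> \<Theta>"
    using open_\<Theta> assms open_contains_ball by blast
  show thesis
    by (rule that[OF e(1)]) (use e(2) in \<open>auto simp: dist_real_def subset_iff\<close>)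
qed

text \<open>The identity is dominated by \<open>(exp (s * x) + exp (- s * x)) / s\<close>, which is
  integrable because openness of \<open>\<Theta>\<close> allows a small tilt in both
  directions.\<close>

lemma integrable_id_tilted:
  assumes "\<theta> \<in> \<Theta>"
  shows "integrable (tilted \<theta>) (\<lambda>x. x)"
proof -
  obtain e where e: "e > 0" "\<And>s. \<bar>s\<bar> < e \<Longrightarrow> \<theta> + s \<in> \<Theta>"
    using ball_\<Theta>[OF assms] by blast
  define s where "s = e / 2"
  have s: "s > 0" "\<theta> + s \<in> \<Theta>" "\<theta> + (- s) \<in> \<Theta>" using e(1) e(2)[of s] e(2)[of "- s"] by (auto simp: s_def)
  have "integrable (tilted \<theta>) (\<lambda>x. (exp (s * x) + exp (- s * x)) / s)"
    by (intro integrable_divide_zero Bochner_Integration.integrable_add mgf_tilted assms s(2,3))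
  then show ?thesis
  proof (rule Bochner_Integration.integrable_bound)
    have "\<bar>x\<bar> \<le> (exp (s * x) + exp (- s * x)) / s" for x :: real
    proof -
      have "s * x \<le> exp (s * x)" "- s * x \<le> exp (- s * x)" "exp (s * x) \<ge> 0" "exp (- s * x) \<ge> 0"
        using exp_ge_add_one_self[of "s * x"] exp_ge_add_one_self[of "- s * x"]
        by (linarith, linarith, simp_all)
      then have "s * \<bar>x\<bar> \<le> exp (s * x) + exp (- s * x)"
        by (cases "x \<ge> 0") (simp_all add: add_increasing add_increasing2)
      then show ?thesis using s(1) by (simp add: field_simps)
    qed
    then show "AE x in tilted \<theta>. norm x \<le> norm ((exp (s * x) + exp (- s * x)) / s)"
      using s(1) by (intro AE_I2) simp
  qed simp
qed

text \<open>Since \<open>1 + s E x \<le> E exp (s x) = exp (b (\<theta> + s) - b \<theta>)\<close> with equality at \<open>s = 0\<close>, the two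
  sides have the same derivative there.\<close>
lemma integral_id_tilted:
  assumes "\<theta> \<in> \<Theta>"
  shows "(\<integral>x. x \<partial>tilted \<theta>) = deriv b \<theta>"
proof -
  interpret prob_space "tilted \<theta>" by (rule prob_space_tilted[OF assms])
  obtain e where e: "e > 0" "\<And>s. \<bar>s\<bar> < e \<Longrightarrow> \<theta> + s \<in> \<Theta>"
    using ball_\<Theta>[OF assms] by blast
  define E where "E = (\<integral>x. x \<partial>tilted \<theta>)"
  define f where "f s = exp (b (\<theta> + s) - b \<theta>) - s * E" for s
  have "(f has_real_derivative deriv b \<theta> - E) (at 0)"
  proof -
    have *: "((\<lambda>s. b (\<theta> + s)) has_real_derivative deriv b \<theta>) (at 0)"
      using DERIV_b[OF assms] DERIV_shift[of b "deriv b \<theta>" 0 \<theta>] by (simp add: add.commute)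
    show ?thesis unfolding f_def by (auto intro!: derivative_eq_intros *)
  qed
  moreover have "f 0 \<le> f s" if "\<bar>0 - s\<bar> < e" for s
  proof -
    have s: "\<theta> + s \<in> \<Theta>" using that e by simp
    have "1 + s * E = (\<integral>x. 1 + s * x \<partial>tilted \<theta>)"
      using integrable_id_tilted[OF assms] by (simp add: E_def prob_space)
    also have "\<dots> \<le> (\<integral>x. exp (s * x) \<partial>tilted \<theta>)"
      using integrable_id_tilted[OF assms] mgf_tilted[OF assms s]
      by (intro integral_mono) auto
    finally show ?thesis using mgf_tilted[OF assms s] by (simp add: f_def)
  qed
  ultimately have "deriv b \<theta> - E = 0"
    using DERIV_local_min[of f _ 0 e] e(1) by blast
  then show ?thesis by (simp add: E_def)
qed

text \<open>Jensen's inequality for \<open>exp\<close> under \<open>tilted \<theta>\<close>, through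
  the tangent to \<open>exp\<close> at \<open>c\<close>, the mean of \<open>s * x\<close>.\<close>

lemma subgradient:
  assumes "\<theta> \<in> \<Theta>" "\<theta>' \<in> \<Theta>"
  shows "(\<theta>' - \<theta>) * deriv b \<theta> \<le> b \<theta>' - b \<theta>"
proof -
  interpret prob_space "tilted \<theta>" by (rule prob_space_tilted[OF assms(1)])
  define s c where "s = \<theta>' - \<theta>" and "c = s * deriv b \<theta>"
  have s: "\<theta> + s \<in> \<Theta>" using assms by (simp add: s_def)
  have "exp c = (\<integral>x. exp c * (1 + (s * x - c)) \<partial>tilted \<theta>)"
    using integrable_id_tilted[OF assms(1)] integral_id_tilted[OF assms(1)]
    by (simp add: prob_space c_def)
  also have "\<dots> \<le> (\<integral>x. exp (s * x) \<partial>tilted \<theta>)"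
  proof (intro integral_mono)
    fix x :: real
    have "exp c * (1 + (s * x - c)) \<le> exp c * exp (s * x - c)"
      by (intro mult_left_mono exp_ge_add_one_self) simp
    then show "exp c * (1 + (s * x - c)) \<le> exp (s * x)"
      by (simp add: exp_add[symmetric])
  qed (use integrable_id_tilted[OF assms(1)] mgf_tilted[OF assms(1) s] in auto)
  finally show ?thesis
    using mgf_tilted[OF assms(1) s] by (simp add: c_def s_def)
qed

text \<open>Adding the subgradient inequalities at both points gives monotonicity; injectivity of
  the mean map makes it strict.\<close>

lemma strict_mono_mean:
  assumes "\<theta> \<in> \<Theta>" "\<theta>' \<in> \<Theta>" "\<theta> < \<theta>'"
  shows "deriv b \<theta> < deriv b \<theta>'"
proof -
  have "(\<theta>' - \<theta>) * deriv b \<theta> \<le> (\<theta>' - \<theta>) * deriv b \<theta>'"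
    using subgradient[OF assms(1,2)] subgradient[OF assms(2,1)] by (simp add: algebra_simps)
  moreover have "deriv b \<theta> \<noteq> deriv b \<theta>'"
    using inj_mean assms by (auto dest: inj_onD)
  ultimately show ?thesis using assms(3) by simp
qed

section \<open>The mean parametrisation\<close>

lemma th_deriv: "\<theta> \<in> \<Theta> \<Longrightarrow> th (deriv b \<theta>) = \<theta>"
  unfolding theta_of_def using inj_mean by (auto dest: inj_onD)

lemma th_in: "x \<in> M \<Longrightarrow> th x \<in> \<Theta>" and deriv_th: "x \<in> M \<Longrightarrow> deriv b (th x) = x"
  using th_deriv unfolding meanset_def by auto

lemma th_image: "th ` M = \<Theta>"
  using th_in th_deriv unfolding meanset_def by force

lemma th_mono: "x \<in> M \<Longrightarrow> y \<in> M \<Longrightarrow> x < y \<Longrightarrow> th x < th y"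
  by (metis deriv_th linorder_neqE_linordered_idom order_less_asym strict_mono_mean th_in)

text \<open>A monotone map whose image is open cannot jump; here the image of \<open>M\<close> is
  the open set \<open>\<Theta>\<close>.\<close>

lemma continuous_th: "continuous_on M th"
  by (rule continuous_onI_mono)
     (auto simp: th_image open_\<Theta> order_le_less intro: th_mono)

section \<open>Kullback-Leibler divergence as a Bregman divergence\<close>

lemma member_eq_tilted: "member \<rho> \<Theta> x = tilted (th x)"
  by (simp add: member_def tilted_def)

text \<open>For \<open>x\<close> in \<open>M\<close> this is the Bregman divergence of
  \<open>b\<close> in mean coordinates: the gap at \<open>th y\<close> between \<open>b\<close> and
  its tangent at \<open>th x\<close>.\<close>

definition D :: "real \<Rightarrow> real \<Rightarrow> real" where
  "D x y = (th x - th y) * x - b (th x) + b (th y)"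

text \<open>The log-likelihood ratio of two members is affine, so its expectation under the first
  involves that member only through its mean \<open>x\<close> and the normalising constants.\<close>

lemma kl_eq_D:
  assumes "x \<in> M" "y \<in> M"
  shows "kl \<rho> \<Theta> x y = D x y"
proof -
  interpret Y: prob_space "tilted (th y)" by (rule prob_space_tilted[OF th_in[OF assms(2)]])
  interpret X: prob_space "tilted (th x)" by (rule prob_space_tilted[OF th_in[OF assms(1)]])
  define f where "f z = exp (z * (th x - th y) - b (th x) + b (th y))" for z
  have [measurable]: "f \<in> borel_measurable borel" by (simp add: f_def[abs_def])
  have eq: "tilted (th x) = density (tilted (th y)) (\<lambda>z. ennreal (f z))"
    unfolding tilted_def
    by (subst density_density_eq)
      (auto simp: f_def ennreal_mult[symmetric] exp_add[symmetric] algebra_simps)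
  have "kl \<rho> \<Theta> x y = (\<integral>z. f z * log (exp 1) (f z) \<partial>tilted (th y))"
    unfolding kl_def member_eq_tilted eq
    by (subst Y.KL_density) (auto simp: f_def)
  also have "\<dots> = (\<integral>z. log (exp 1) (f z) \<partial>tilted (th x))"
    unfolding eq by (subst integral_real_density) (auto simp: f_def)
  also have "\<dots> = (\<integral>z. z * (th x - th y) + (b (th y) - b (th x)) \<partial>tilted (th x))"
    by (simp add: f_def log_def algebra_simps)
  also have "\<dots> = D x y"
    using integrable_id_tilted[OF th_in[OF assms(1)]] integral_id_tilted[OF th_in[OF assms(1)]]
    by (subst Bochner_Integration.integral_add)
      (auto simp: X.prob_space D_def deriv_th[OF assms(1)])
  finally show ?thesis .
qed

lemma D_nonneg: "x \<in> M \<Longrightarrow> y \<in> M \<Longrightarrow> 0 \<le> D x y"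
  using subgradient[OF th_in th_in, of x y] deriv_th[of x] by (simp add: D_def algebra_simps)

text \<open>The generalised Pythagorean identity of Bregman divergences; the cost decompositions for
  pairs of arms rest on it.\<close>

lemma D_three_point: "D x y = D x z + D z y + (x - z) * (th z - th y)"
  by (simp add: D_def algebra_simps)

lemma D_self [simp]: "D x x = 0"
  by (simp add: D_def)

text \<open>The midpoint \<open>z\<close> splits the divergence into two nonnegative ones and a
  cross term, which is positive since \<open>th\<close> is strictly increasing.\<close>

lemma D_pos:
  assumes "x \<in> M" "y \<in> M" "x \<noteq> y"
  shows "0 < D x y"
proof -
  define z where "z = (x + y) / 2"
  have z: "z \<in> M"
    using convexD[OF convex_M assms(1,2), of "1/2" "1/2"] by (simp add: z_def add_divide_distrib)
  have "(x - z) * (th z - th y) > 0"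
  proof (cases "x < y")
    case True
    then show ?thesis using th_mono[OF z assms(2)] by (intro mult_neg_neg) (auto simp: z_def)
  next
    case False
    then show ?thesis using th_mono[OF assms(2) z] assms(3)
      by (intro mult_pos_pos) (auto simp: z_def)
  qed
  then show ?thesis
    using D_three_point[of x y z] D_nonneg[OF assms(1) z] D_nonneg[OF z assms(2)] by linarith
qed

lemma tendsto_D:
  assumes "(f \<longlongrightarrow> x) F" "(g \<longlongrightarrow> y) F" "x \<in> M" "y \<in> M"
  shows "((\<lambda>i. D (f i) (g i)) \<longlongrightarrow> D x y) F"
proof -
  have th: "isCont th u" if "u \<in> M" for u
    using continuous_th open_M that continuous_on_eq_continuous_at by blast
  have b: "isCont b (th u)" if "u \<in> M" for u
    using DERIV_b[OF th_in[OF that]] DERIV_isCont by blast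
  show ?thesis unfolding D_def
    by (intro tendsto_intros assms isCont_tendsto_compose[OF b] isCont_tendsto_compose[OF th])
qed

end

section \<open>Characteristic time\<close>

text \<open>Bolzano-Weierstrass for the first \<open>n\<close> coordinates: weights are functions on
  all of \<open>nat\<close>, with nothing known beyond \<open>n\<close>. Each induction step refines
  the subsequence for one more coordinate.\<close>

lemma finite_coordinates_convergent_subseq:
  fixes f :: "nat \<Rightarrow> nat \<Rightarrow> real"
  assumes "\<And>m i. i < n \<Longrightarrow> f m i \<in> {0..1}"
  shows "\<exists>r w. strict_mono r \<and> (\<forall>i<n. (\<lambda>m. f (r m) i) \<longlonglongrightarrow> w i)"
  using assms
proof (induction n)
  case 0
  show ?case by (rule exI[of _ id]) (simp add: strict_mono_def)
next
  case (Suc n)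
  then obtain r w where r: "strict_mono r" "\<forall>i<n. (\<lambda>m. f (r m) i) \<longlonglongrightarrow> w i"
    by (metis less_SucI)
  have "bounded (range (\<lambda>m. f (r m) n))"
    by (rule bounded_subset[of "{0..1}"]) (use Suc.prems in auto)
  then obtain l s where s: "strict_mono s" "((\<lambda>m. f (r m) n) \<circ> s) \<longlonglongrightarrow> l"
    using bounded_imp_convergent_subsequence by blast
  have "(\<lambda>m. f ((r \<circ> s) m) i) \<longlonglongrightarrow> (w(n := l)) i" if "i < Suc n" for i
  proof (cases "i = n")
    case True
    then show ?thesis using s(2) by (simp add: o_def)
  next
    case False
    then have "(\<lambda>m. f (r m) i) \<longlonglongrightarrow> w i" using r that by simp
    from LIMSEQ_subseq_LIMSEQ[OF this s(1)] show ?thesis using False by (simp add: o_def)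
  qed
  then show ?case
    using strict_mono_o[OF r(1) s(1)] by blast
qed

lemma prob_simplex_coord: "w \<in> prob_simplex n \<Longrightarrow> i < n \<Longrightarrow> w i \<in> {0..1}"
  unfolding prob_simplex_def using member_le_sum[of i "{..<n}" w] by auto

lemma prob_simplex_closed:
  assumes "\<And>m. ws m \<in> prob_simplex n" "\<And>i. i < n \<Longrightarrow> (\<lambda>m. ws m i) \<longlonglongrightarrow> w i"
  shows "w \<in> prob_simplex n"
proof -
  have "0 \<le> w i" if "i < n" for i
    by (rule LIMSEQ_le_const[OF assms(2)[OF that]])
      (use assms(1) that in \<open>auto simp: prob_simplex_def\<close>)
  moreover have "(\<lambda>m. \<Sum>i<n. ws m i) \<longlonglongrightarrow> (\<Sum>i<n. w i)"
    by (intro tendsto_sum assms(2)) simp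
  then have "(\<Sum>i<n. w i) = 1"
    using assms(1) by (simp add: prob_simplex_def LIMSEQ_const_iff)
  ultimately show ?thesis by (simp add: prob_simplex_def)
qed

section \<open>Costs of giving two arms a common mean\<close>

context exp_family
begin

definition wmean :: "real \<Rightarrow> real \<Rightarrow> real \<Rightarrow> real \<Rightarrow> real" where
  "wmean a c x z = (a * x + c * z) / (a + c)"

text \<open>The least weighted cost of moving both arms to a common mean, attained at the pooled
  mean. With pull counts as weights it is the statistic of Stage III.\<close>

definition G :: "real \<Rightarrow> real \<Rightarrow> real \<Rightarrow> real \<Rightarrow> real" where
  "G a c x z = a * D x (wmean a c x z) + c * D z (wmean a c x z)"

lemma wmean_in:
  assumes "0 \<le> a" "0 \<le> c" "0 < a + c" "x \<in> M" "z \<in> M"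
  shows "wmean a c x z \<in> M"
proof -
  have "(a / (a + c)) *\<^sub>R x + (c / (a + c)) *\<^sub>R z \<in> M"
    using assms by (intro convexD[OF convex_M]) (auto simp: add_divide_distrib[symmetric])
  then show ?thesis by (simp add: wmean_def add_divide_distrib)
qed

lemma wmean_balance: "a + c \<noteq> 0 \<Longrightarrow> a * (x - wmean a c x z) + c * (z - wmean a c x z) = 0"
  by (simp add: wmean_def field_simps)

text \<open>Both divergences are split at the pooled mean. The weighted deviations from it balance,
  so the cross terms cancel and the excess over \<open>G\<close> is a single divergence.\<close>

lemma G_decomposition:
  assumes "a + c \<noteq> 0"
  shows "a * D x y + c * D z y = G a c x z + (a + c) * D (wmean a c x z) y"
proof -
  let ?m = "wmean a c x z"
  have "a * D x y + c * D z y = G a c x z + (a + c) * D ?m y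
      + (a * (x - ?m) + c * (z - ?m)) * (th ?m - th y)"
    unfolding G_def by (subst D_three_point[of x y ?m], subst D_three_point[of z y ?m])
      (simp add: algebra_simps)
  then show ?thesis using wmean_balance[OF assms] by simp
qed

lemma G_le:
  assumes "0 \<le> a" "0 \<le> c" "0 < a + c" "x \<in> M" "z \<in> M" "y \<in> M"
  shows "G a c x z \<le> a * D x y + c * D z y"
  using G_decomposition[of a c x y z] D_nonneg[OF wmean_in[OF assms(1-5)] assms(6)] assms(3)
  by simp

text \<open>An alternative need not give both arms the same mean. With targets
  \<open>y \<le> y'\<close> the cross terms no longer cancel but leave
  \<open>p * (th y' - th y)\<close>, where \<open>p\<close> is nonnegative because
  \<open>z < x\<close>.\<close>

lemma G_le_separated:
  assumes "0 \<le> a" "0 \<le> c" "0 < a + c" "x \<in> M" "z \<in> M" "z < x"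
    and "y \<in> M" "y' \<in> M" "y \<le> y'"
  shows "G a c x z \<le> a * D x y + c * D z y'"
proof -
  let ?m = "wmean a c x z"
  have m: "?m \<in> M" by (rule wmean_in) fact+
  define p where "p = a * (x - ?m)"
  have p: "c * (z - ?m) = - p"
    using wmean_balance[of a c x z] assms(3) by (simp add: p_def)
  have "p = a * c * (x - z) / (a + c)"
    using assms(3) by (simp add: p_def wmean_def field_simps)
  then have "p \<ge> 0" using assms by simp
  have "th y \<le> th y'" using th_mono[of y y'] assms by (cases "y = y'") auto
  have "a * D x y + c * D z y' = G a c x z + a * D ?m y + c * D ?m y' + p * (th ?m - th y)
      + (c * (z - ?m)) * (th ?m - th y')"
    unfolding G_def p_def by (subst D_three_point[of x y ?m], subst D_three_point[of z y' ?m])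
      (simp add: algebra_simps)
  also have "\<dots> = G a c x z + a * D ?m y + c * D ?m y' + p * (th y' - th y)"
    unfolding p by (simp add: algebra_simps)
  finally show ?thesis
    using D_nonneg[OF m assms(7)] D_nonneg[OF m assms(8)] assms(1,2) \<open>p \<ge> 0\<close> \<open>th y \<le> th y'\<close>
    by simp
qed

text \<open>At a fixed common mean the cost increases with the weights; comparing at the pooled mean
  of the larger pair transfers this to \<open>G\<close>. More pulls thus give a larger
  statistic.\<close>

lemma G_mono:
  assumes "0 \<le> a" "0 \<le> c" "0 < a + c" "a \<le> a'" "c \<le> c'" "x \<in> M" "z \<in> M"
  shows "G a c x z \<le> G a' c' x z"
proof -
  have m: "wmean a' c' x z \<in> M" using assms by (intro wmean_in) auto
  have "G a c x z \<le> a * D x (wmean a' c' x z) + c * D z (wmean a' c' x z)"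
    by (rule G_le) (use assms m in auto)
  also have "\<dots> \<le> G a' c' x z"
    unfolding G_def by (intro add_mono mult_right_mono D_nonneg assms m)
  finally show ?thesis .
qed

lemma G_scale: "s \<noteq> 0 \<Longrightarrow> G (s * a) (s * c) x z = s * G a c x z"
proof -
  assume "s \<noteq> 0"
  then have "wmean (s * a) (s * c) x z = wmean a c x z"
    by (simp add: wmean_def distrib_left[symmetric] mult.assoc)
  then show ?thesis by (simp add: G_def algebra_simps)
qed

lemma G_pos:
  assumes "0 < a" "0 < c" "x \<in> M" "z \<in> M" "x \<noteq> z"
  shows "0 < G a c x z"
proof -
  have m: "wmean a c x z \<in> M" using assms by (intro wmean_in) auto
  have "x - wmean a c x z = c * (x - z) / (a + c)"
    using assms by (simp add: wmean_def field_simps)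
  then have "x \<noteq> wmean a c x z" using assms by auto
  then have "0 < a * D x (wmean a c x z)" using D_pos[OF assms(3) m] assms(1) by simp
  moreover have "0 \<le> c * D z (wmean a c x z)" using D_nonneg[OF assms(4) m] assms(2) by simp
  ultimately show ?thesis by (simp add: G_def)
qed

lemma tendsto_G:
  assumes "(a \<longlongrightarrow> a0) F" "(c \<longlongrightarrow> c0) F" "(x \<longlongrightarrow> x0) F" "(z \<longlongrightarrow> z0) F"
    and "0 \<le> a0" "0 \<le> c0" "0 < a0 + c0" "x0 \<in> M" "z0 \<in> M"
  shows "((\<lambda>i. G (a i) (c i) (x i) (z i)) \<longlongrightarrow> G a0 c0 x0 z0) F"
proof -
  have m: "((\<lambda>i. wmean (a i) (c i) (x i) (z i)) \<longlongrightarrow> wmean a0 c0 x0 z0) F"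
    unfolding wmean_def using assms by (intro tendsto_intros) auto
  show ?thesis unfolding G_def
    using assms by (intro tendsto_intros tendsto_D m wmean_in)
qed

text \<open>The minimising common mean of two non-proportional weightings differs, so \<open>G\<close> is strictly
  concave between them.\<close>
lemma G_midpoint:
  assumes "0 < a" "0 < c" "0 < a'" "0 < c'" "x \<in> M" "z \<in> M"
  shows "(G a c x z + G a' c' x z) / 2 \<le> G ((a + a') / 2) ((c + c') / 2) x z"
    and "x \<noteq> z \<Longrightarrow> a * c' \<noteq> a' * c \<Longrightarrow>
      (G a c x z + G a' c' x z) / 2 < G ((a + a') / 2) ((c + c') / 2) x z"
proof -
  define y where "y = wmean ((a + a') / 2) ((c + c') / 2) x z"
  have y: "y \<in> M" unfolding y_def using assms by (intro wmean_in) (auto simp: add_pos_pos)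
  have m: "wmean a c x z \<in> M" "wmean a' c' x z \<in> M" using assms by (auto intro!: wmean_in)
  \<comment> \<open>By the decomposition at \<open>y\<close>, the concavity gap is exactly half the
    weighted sum of the divergences from the two pooled means to \<open>y\<close>.\<close>
  have eq: "G ((a + a') / 2) ((c + c') / 2) x z =
      (G a c x z + G a' c' x z) / 2
      + ((a + c) * D (wmean a c x z) y + (a' + c') * D (wmean a' c' x z) y) / 2"
  proof -
    have "2 * G ((a + a') / 2) ((c + c') / 2) x z =
        (a * D x y + c * D z y) + (a' * D x y + c' * D z y)"
      unfolding G_def y_def[symmetric] by (simp add: algebra_simps add_divide_distrib)
    moreover have "a + c \<noteq> 0" "a' + c' \<noteq> 0" using assms by auto
    ultimately show ?thesis
      using G_decomposition[of a c x y z] G_decomposition[of a' c' x y z] by argo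
  qed
  show "(G a c x z + G a' c' x z) / 2 \<le> G ((a + a') / 2) ((c + c') / 2) x z"
    unfolding eq using D_nonneg[OF m(1) y] D_nonneg[OF m(2) y] assms by simp
  assume "x \<noteq> z" "a * c' \<noteq> a' * c"
  have "wmean a c x z - wmean a' c' x z = (a * c' - a' * c) * (x - z) / ((a + c) * (a' + c'))"
    using assms by (simp add: wmean_def field_simps)
  then have "wmean a c x z - wmean a' c' x z \<noteq> 0"
    using \<open>x \<noteq> z\<close> \<open>a * c' \<noteq> a' * c\<close> assms by auto
  \<comment> \<open>Distinct pooled means cannot both equal \<open>y\<close>, so at least one of
    these divergences is positive.\<close>
  then have "wmean a c x z \<noteq> y \<or> wmean a' c' x z \<noteq> y" by auto
  then have "0 < (a + c) * D (wmean a c x z) y + (a' + c') * D (wmean a' c' x z) y"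
  proof
    assume "wmean a c x z \<noteq> y"
    then show ?thesis
      using D_pos[OF m(1) y] D_nonneg[OF m(2) y] assms
      by (intro add_pos_nonneg mult_pos_pos mult_nonneg_nonneg) auto
  next
    assume "wmean a' c' x z \<noteq> y"
    then show ?thesis
      using D_pos[OF m(2) y] D_nonneg[OF m(1) y] assms
      by (intro add_nonneg_pos mult_pos_pos mult_nonneg_nonneg) auto
  qed
  then show "(G a c x z + G a' c' x z) / 2 < G ((a + a') / 2) ((c + c') / 2) x z"
    unfolding eq by simp
qed

end

section \<open>Reduction of the characteristic-time problem to pairs of arms\<close>

locale bandit = exp_family +
  fixes n k :: nat
  assumes n2: "2 \<le> n"
begin

abbreviation "cv \<equiv> charval \<rho> \<Theta> n k"
abbreviation "Tinv \<equiv> Tstar_inv \<rho> \<Theta> n k"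
abbreviation "valid \<equiv> valid_inst \<rho> \<Theta> n k"
abbreviation "Wst \<equiv> wstar \<rho> \<Theta> n k"
abbreviation "Tst \<equiv> Tstar \<rho> \<Theta> n k"

lemma valid_in: "valid l \<Longrightarrow> i < n \<Longrightarrow> l i \<in> M"
  and valid_k: "valid l \<Longrightarrow> k < n"
  and valid_less: "valid l \<Longrightarrow> j < n \<Longrightarrow> j \<noteq> k \<Longrightarrow> l j < l k"
  by (simp_all add: valid_inst_def)

lemma other_arm: obtains j where "j < n" "j \<noteq> k"
proof (cases "k = 0")
  case True then show thesis using n2 that[of 1] by simp
next
  case False then show thesis using n2 that[of 0] by simp
qed

text \<open>A common lower bound passes to an infimum of reals only over a non-empty index set.
  Openness of \<open>M\<close> supplies two distinct means.\<close>

lemma Alt_nonempty: "Alt \<rho> \<Theta> n k \<noteq> {}"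
proof -
  obtain j where j: "j < n" "j \<noteq> k" by (rule other_arm)
  obtain y where y: "y \<in> M" using M_nonempty by blast
  obtain e where e: "e > 0" "ball y e \<subseteq> M" using open_M y open_contains_ball by blast
  have "y + e / 2 \<in> M" using e by (auto simp: subset_iff dist_real_def)
  then have "(\<lambda>i. if i = j then y + e / 2 else y) \<in> Alt \<rho> \<Theta> n k"
    unfolding Alt_def using j y e by auto
  then show ?thesis by blast
qed

lemma cost_eq:
  "valid l \<Longrightarrow> l' \<in> Alt \<rho> \<Theta> n k \<Longrightarrow>
    (\<Sum>i<n. w i * kl \<rho> \<Theta> (l i) (l' i)) = (\<Sum>i<n. w i * D (l i) (l' i))"
  by (intro sum.cong refl) (auto simp: Alt_def valid_in kl_eq_D)

lemma charval_le_cost: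
  assumes "valid l" "w \<in> prob_simplex n" "l' \<in> Alt \<rho> \<Theta> n k"
  shows "cv l w \<le> (\<Sum>i<n. w i * D (l i) (l' i))"
proof -
  have "bdd_below ((\<lambda>l'. \<Sum>i<n. w i * kl \<rho> \<Theta> (l i) (l' i)) ` Alt \<rho> \<Theta> n k)"
  proof (intro bdd_belowI2[of _ 0])
    fix l' assume l': "l' \<in> Alt \<rho> \<Theta> n k"
    show "0 \<le> (\<Sum>i<n. w i * kl \<rho> \<Theta> (l i) (l' i))"
      unfolding cost_eq[OF assms(1) l']
      by (intro sum_nonneg mult_nonneg_nonneg D_nonneg valid_in[OF assms(1)])
        (use assms(2) l' in \<open>auto simp: prob_simplex_def Alt_def\<close>)
  qed
  from cINF_lower[OF this assms(3)] show ?thesis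
    by (simp add: charval_def cost_eq[OF assms(1,3)])
qed

lemma charval_geI:
  assumes "valid l" "\<And>l'. l' \<in> Alt \<rho> \<Theta> n k \<Longrightarrow> v \<le> (\<Sum>i<n. w i * D (l i) (l' i))"
  shows "v \<le> cv l w"
  unfolding charval_def
  by (rule cINF_greatest[OF Alt_nonempty]) (use assms cost_eq in auto)

text \<open>Moving arms \<open>k\<close> and \<open>j\<close> to one mean \<open>y\<close> is not an
  alternative, since a strict order is demanded. Arm \<open>j\<close> goes to
  \<open>y + 1 / (m + 1)\<close> instead, and the inequality survives the limit.\<close>

lemma charval_le:
  assumes l: "valid l" and w: "w \<in> prob_simplex n" and j: "j < n" "j \<noteq> k" and y: "y \<in> M"
  shows "cv l w \<le> w k * D (l k) y + w j * D (l j) y"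
proof -
  have k: "k < n" by (rule valid_k[OF l])
  have lim: "(\<lambda>m. y + 1 / real (Suc m)) \<longlonglongrightarrow> y"
    using tendsto_add[OF tendsto_const LIMSEQ_inverse_real_of_nat, of y]
    by (simp add: inverse_eq_divide)
  have "(\<lambda>m. w k * D (l k) y + w j * D (l j) (y + 1 / real (Suc m)))
      \<longlonglongrightarrow> w k * D (l k) y + w j * D (l j) y"
    by (intro tendsto_intros tendsto_D lim valid_in[OF l] j y)
  moreover have "\<forall>\<^sub>F m in sequentially.
      cv l w \<le> w k * D (l k) y + w j * D (l j) (y + 1 / real (Suc m))"
    using topological_tendstoD[OF lim open_M y]
  proof eventually_elim
    case (elim m)
    define l' where "l' = l(k := y, j := y + 1 / real (Suc m))"
    have "l' \<in> Alt \<rho> \<Theta> n k"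
      unfolding Alt_def using j elim y valid_in[OF l] by (auto simp: l'_def intro!: exI[of _ j])
    then have "cv l w \<le> (\<Sum>i<n. w i * D (l i) (l' i))"
      by (rule charval_le_cost[OF l w])
    also have "\<dots> = (\<Sum>i\<in>{k, j}. w i * D (l i) (l' i))"
      by (intro sum.mono_neutral_right) (use j k in \<open>auto simp: l'_def\<close>)
    also have "\<dots> = w k * D (l k) y + w j * D (l j) (y + 1 / real (Suc m))"
      using j by (simp add: l'_def)
    finally show ?case .
  qed
  ultimately show ?thesis
    by (intro tendsto_lowerbound) auto
qed

text \<open>In an alternative some arm \<open>j\<close> overtakes \<open>k\<close>. Dropping the
  nonnegative costs of the other arms leaves a separated pair, whose cost is at least
  \<open>G\<close>.\<close>

lemma charval_ge:
  assumes l: "valid l" and w: "w \<in> prob_simplex n"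
    and pos: "\<And>j. j < n \<Longrightarrow> j \<noteq> k \<Longrightarrow> 0 < w k + w j"
    and v: "\<And>j. j < n \<Longrightarrow> j \<noteq> k \<Longrightarrow> v \<le> G (w k) (w j) (l k) (l j)"
  shows "v \<le> cv l w"
proof (rule charval_geI[OF l])
  fix l' assume l': "l' \<in> Alt \<rho> \<Theta> n k"
  then obtain j where j: "j < n" "j \<noteq> k" "l' k < l' j" by (auto simp: Alt_def)
  have k: "k < n" by (rule valid_k[OF l])
  have M': "l' i \<in> M" if "i < n" for i using l' that by (auto simp: Alt_def)
  have w0: "0 \<le> w i" if "i < n" for i using w that by (auto simp: prob_simplex_def)
  have "v \<le> w k * D (l k) (l' k) + w j * D (l j) (l' j)"
    using v[OF j(1,2)] G_le_separated[OF w0 w0 pos[OF j(1,2)] valid_in[OF l k] valid_in[OF l j(1)]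
        valid_less[OF l j(1,2)] M'[OF k] M'[OF j(1)]] k j by simp
  also have "\<dots> = (\<Sum>i\<in>{k, j}. w i * D (l i) (l' i))"
    using j by simp
  also have "\<dots> \<le> (\<Sum>i<n. w i * D (l i) (l' i))"
    by (intro sum_mono2 mult_nonneg_nonneg D_nonneg)
      (use j k valid_in[OF l] M' w0 in auto)
  finally show "v \<le> (\<Sum>i<n. w i * D (l i) (l' i))" .
qed

lemma charval_le_Tinv:
  assumes "valid l" "w \<in> prob_simplex n"
  shows "cv l w \<le> Tinv l"
  unfolding Tstar_inv_def
proof (rule cSUP_upper[OF assms(2)])
  obtain j where j: "j < n" "j \<noteq> k" by (rule other_arm)
  have k: "k < n" by (rule valid_k[OF assms(1)])
  show "bdd_above (cv l ` prob_simplex n)"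
  \<comment> \<open>Raising arm \<open>j\<close> alone to the mean of arm \<open>k\<close> gives a
    bound that does not depend on the weights.\<close>
  proof (intro bdd_aboveI2[of _ _ "D (l j) (l k)"])
    fix w assume w: "w \<in> prob_simplex n"
    have "cv l w \<le> w k * D (l k) (l k) + w j * D (l j) (l k)"
      by (rule charval_le[OF assms(1) w j valid_in[OF assms(1) k]])
    also have "\<dots> \<le> D (l j) (l k)"
      using prob_simplex_coord[OF w j(1)] D_nonneg[of "l j" "l k"] valid_in[OF assms(1)] j k
      by (simp add: mult_left_le_one_le)
    finally show "cv l w \<le> D (l j) (l k)" .
  qed
qed

section \<open>Positive value, existence and uniqueness of the optimal weights\<close>

lemma uniform_in_simplex: "(\<lambda>i. 1 / real n) \<in> prob_simplex n"
  using n2 by (simp add: prob_simplex_def)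

text \<open>Uniform weights already make each of the finitely many two-arm costs positive.\<close>

lemma Tinv_pos:
  assumes l: "valid l"
  shows "0 < Tinv l"
proof -
  define v where "v = Min ((\<lambda>j. G (1 / n) (1 / n) (l k) (l j)) ` ({..<n} - {k}))"
  have fin: "finite ((\<lambda>j. G (1 / n) (1 / n) (l k) (l j)) ` ({..<n} - {k}))" by simp
  obtain j where j: "j < n" "j \<noteq> k" by (rule other_arm)
  have "0 < v"
    unfolding v_def
  proof (subst Min_gr_iff[OF fin])
    show "\<forall>a\<in>(\<lambda>j. G (1 / n) (1 / n) (l k) (l j)) ` ({..<n} - {k}). 0 < a"
      using n2 valid_in[OF l] valid_k[OF l] valid_less[OF l] by (force intro!: G_pos)
  qed (use j in auto)
  also have "v \<le> cv l (\<lambda>i. 1 / real n)"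
    by (rule charval_ge[OF l uniform_in_simplex]) (use n2 in \<open>auto simp: v_def intro!: Min_le\<close>)
  also have "\<dots> \<le> Tinv l" by (rule charval_le_Tinv[OF l uniform_in_simplex])
  finally show ?thesis .
qed

text \<open>For each fixed alternative the cost is jointly continuous in instance and weights, and
  the set of alternatives is the same for all instances. The bounds \<open>vs m\<close> therefore
  pass to the limit before the infimum is taken.\<close>

lemma charval_upper_semicontinuous:
  assumes l: "valid l" "\<And>m. valid (ls m)" "\<And>i. i < n \<Longrightarrow> (\<lambda>m. ls m i) \<longlonglongrightarrow> l i"
    and w: "\<And>m. ws m \<in> prob_simplex n" "\<And>i. i < n \<Longrightarrow> (\<lambda>m. ws m i) \<longlonglongrightarrow> w i"
    and v: "vs \<longlonglongrightarrow> v" "\<And>m. vs m \<le> cv (ls m) (ws m)"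
  shows "v \<le> cv l w"
proof (rule charval_geI[OF l(1)])
  fix l' assume l': "l' \<in> Alt \<rho> \<Theta> n k"
  have "(\<lambda>m. \<Sum>i<n. ws m i * D (ls m i) (l' i)) \<longlonglongrightarrow> (\<Sum>i<n. w i * D (l i) (l' i))"
    using l' l(1) by (intro tendsto_intros tendsto_D l(3) w(2)) (auto simp: Alt_def valid_in)
  then show "v \<le> (\<Sum>i<n. w i * D (l i) (l' i))"
    using order_trans[OF v(2) charval_le_cost[OF l(2) w(1) l']] by (intro LIMSEQ_le[OF v(1)]) auto
qed

text \<open>\<open>wstar\<close> is a choice, so a maximiser must exist: near-maximisers have a
  subsequence converging in the simplex, and by upper semicontinuity its limit attains the
  supremum.\<close>

lemma wstar_maximises:
  assumes l: "valid l"
  shows "Wst l \<in> prob_simplex n" and "cv l (Wst l) = Tinv l"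
proof -
  have "\<exists>w\<in>prob_simplex n. Tinv l - 1 / real (Suc m) < cv l w" for m
    unfolding Tstar_inv_def by (rule less_cSUP_iff[THEN iffD1])
      (use uniform_in_simplex charval_le_Tinv[OF l] in \<open>auto intro!: bdd_aboveI2\<close>)
  then obtain ws where ws: "\<And>m. ws m \<in> prob_simplex n" "\<And>m. Tinv l - 1 / real (Suc m) < cv l (ws m)"
    by metis
  obtain r w where r: "strict_mono r" "\<forall>i<n. (\<lambda>m. ws (r m) i) \<longlonglongrightarrow> w i"
    using finite_coordinates_convergent_subseq[of n ws] prob_simplex_coord[OF ws(1)] by blast
  have w: "w \<in> prob_simplex n"
    by (rule prob_simplex_closed[of "\<lambda>m. ws (r m)"]) (use ws r in auto)
  have lim: "(\<lambda>m. Tinv l - 1 / real (Suc (r m))) \<longlonglongrightarrow> Tinv l"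
  proof -
    have "(\<lambda>m. Tinv l - 1 / real (Suc m)) \<longlonglongrightarrow> Tinv l - 0"
      using LIMSEQ_inverse_real_of_nat by (intro tendsto_intros) (simp add: inverse_eq_divide)
    from LIMSEQ_subseq_LIMSEQ[OF this r(1)] show ?thesis by (simp add: o_def)
  qed
  have "Tinv l \<le> cv l w"
    by (rule charval_upper_semicontinuous[OF l, of "\<lambda>_. l" "\<lambda>m. ws (r m)", OF _ _ _ _ lim])
      (use l ws r in \<open>auto intro: less_imp_le\<close>)
  then have "cv l w = Tinv l" using charval_le_Tinv[OF l w] by simp
  then have "\<exists>w. w \<in> prob_simplex n \<and> cv l w = Tinv l" using w by blast
  from someI_ex[OF this] show "Wst l \<in> prob_simplex n" "cv l (Wst l) = Tinv l"
    unfolding wstar_def by blast+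
qed

text \<open>An arm without weight can be moved for free: arm \<open>k\<close> down to some
  \<open>j\<close>, or arm \<open>i\<close> up to \<open>k\<close>. The value would then be at most
  0.\<close>

lemma maximiser_pos:
  assumes l: "valid l" and w: "w \<in> prob_simplex n" "cv l w = Tinv l" and i: "i < n"
  shows "0 < w i"
proof (rule ccontr)
  assume "\<not> 0 < w i"
  then have i0: "w i = 0" using w(1) i by (force simp: prob_simplex_def)
  have "cv l w \<le> 0"
  proof (cases "i = k")
    case True
    obtain j where j: "j < n" "j \<noteq> k" by (rule other_arm)
    show ?thesis
      using charval_le[OF l w(1) j valid_in[OF l j(1)]] i0 True by simp
  next
    case False
    then show ?thesis
      using charval_le[OF l w(1) i False valid_in[OF l valid_k[OF l]]] i0 by simp
  qed
  then show False using Tinv_pos[OF l] w(2) by simp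
qed

lemma maximiser_G_ge:
  assumes l: "valid l" and w: "w \<in> prob_simplex n" "cv l w = Tinv l" and j: "j < n" "j \<noteq> k"
  shows "Tinv l \<le> G (w k) (w j) (l k) (l j)"
proof -
  have "0 < w k" "0 < w j" using maximiser_pos[OF l w] j valid_k[OF l] by auto
  then show ?thesis
    using charval_le[OF l w(1) j wmean_in[of "w k" "w j" "l k" "l j"]] w(2) valid_in[OF l] j valid_k[OF l]
    by (simp add: G_def)
qed

text \<open>If one constraint were slack at a maximiser, its arm could give up some weight to the others.\<close>
lemma maximiser_tight:
  assumes l: "valid l" and w: "w \<in> prob_simplex n" "cv l w = Tinv l" and j: "j < n" "j \<noteq> k"
  shows "G (w k) (w j) (l k) (l j) \<le> Tinv l"
proof (rule ccontr)
  let ?V = "Tinv l"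
  assume "\<not> ?thesis"
  then have slack: "?V < G (w k) (w j) (l k) (l j)" by simp
  have k: "k < n" by (rule valid_k[OF l])
  have wp: "0 < w i" if "i < n" for i by (rule maximiser_pos[OF l w that])
  have lim: "((\<lambda>t. G (w k) (w j - t) (l k) (l j)) \<longlongrightarrow> G (w k) (w j) (l k) (l j)) (at_right 0)"
  proof (rule tendsto_G)
    have "((\<lambda>t. w j - t) \<longlongrightarrow> w j - 0) (at_right 0)" by (intro tendsto_intros)
    then show "((\<lambda>t. w j - t) \<longlongrightarrow> w j) (at_right 0)" by simp
  qed (use wp[OF k] wp[OF j(1)] valid_in[OF l] k j in auto)
  \<comment> \<open>By continuity of \<open>G\<close>, constraint \<open>j\<close> stays slack when
    a small weight \<open>t\<close> is taken from its arm.\<close>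
  have "\<forall>\<^sub>F t in at_right 0. 0 < t \<and> t < min 1 (w j) \<and> ?V < G (w k) (w j - t) (l k) (l j)"
    by (intro eventually_conj order_tendstoD(1)[OF lim slack] eventually_at_right_less
        order_tendstoD(2)[of "\<lambda>t. t" 0]) (use wp[OF j(1)] in auto)
  then obtain t where t: "0 < t" "t < 1" "t < w j" "?V < G (w k) (w j - t) (l k) (l j)"
    using eventually_happens'[of "at_right (0::real)"] by auto
  \<comment> \<open>Rescaling to total mass 1 redistributes the removed weight and multiplies every
    other constraint by \<open>s > 1\<close>.\<close>
  define s where "s = 1 / (1 - t)"
  have s: "s > 1" using t by (simp add: s_def)
  define u where "u i = s * (if i = j then w j - t else w i)" for i
  have "(\<Sum>i<n. if i = j then w j - t else w i) = (\<Sum>i<n. w i - (if i = j then t else 0))"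
    by (intro sum.cong) auto
  also have "\<dots> = 1 - t"
    using w(1) j(1) by (simp add: sum_subtractf prob_simplex_def)
  finally have "(\<Sum>i<n. u i) = 1"
    using t unfolding u_def by (subst sum_distrib_left[symmetric]) (simp add: s_def)
  moreover have up: "0 < u i" if "i < n" for i
    using wp[OF that] s t by (simp add: u_def)
  ultimately have u: "u \<in> prob_simplex n" by (auto simp: prob_simplex_def less_imp_le)
  define v where "v = min (s * ?V) (s * G (w k) (w j - t) (l k) (l j))"
  have "v \<le> cv l u"
  proof (rule charval_ge[OF l u])
    fix i assume i: "i < n" "i \<noteq> k"
    show "0 < u k + u i" using up i k by (simp add: add_pos_pos)
    show "v \<le> G (u k) (u i) (l k) (l i)"
    proof (cases "i = j")
      case True
      then show ?thesis using j(2) s by (simp add: u_def G_scale v_def)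
    next
      case False
      then have "G (u k) (u i) (l k) (l i) = s * G (w k) (w i) (l k) (l i)"
        using j(2) s by (simp add: u_def G_scale)
      moreover have "s * ?V \<le> s * G (w k) (w i) (l k) (l i)"
        using maximiser_G_ge[OF l w i] s by simp
      ultimately show ?thesis by (simp add: v_def)
    qed
  qed
  moreover have "?V < v"
  proof -
    have "?V < s * ?V" using s Tinv_pos[OF l] by simp
    moreover have "s * ?V < s * G (w k) (w j - t) (l k) (l j)" using s t(4) by simp
    ultimately show ?thesis by (simp add: v_def)
  qed
  ultimately show False using charval_le_Tinv[OF l u] by simp
qed

text \<open>By concavity the average \<open>h\<close> of two maximisers is again a maximiser, hence
  tight in every constraint. Strict concavity then forces equal ratios to the weight of arm
  \<open>k\<close>, and both vectors sum to 1.\<close>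

lemma maximiser_unique:
  assumes l: "valid l" and w: "w \<in> prob_simplex n" "cv l w = Tinv l"
    and u: "u \<in> prob_simplex n" "cv l u = Tinv l" and i: "i < n"
  shows "w i = u i"
proof -
  let ?V = "Tinv l"
  have k: "k < n" by (rule valid_k[OF l])
  have wp: "0 < w i" "0 < u i" if "i < n" for i
    using maximiser_pos[OF l w that] maximiser_pos[OF l u that] by auto
  define h where "h i = (w i + u i) / 2" for i
  have "(\<Sum>i<n. h i) = ((\<Sum>i<n. w i) + (\<Sum>i<n. u i)) / 2"
    by (simp add: h_def sum.distrib sum_divide_distrib[symmetric])
  then have h: "h \<in> prob_simplex n"
    using w u by (auto simp: prob_simplex_def h_def)
  have Gh: "(G (w k) (w j) (l k) (l j) + G (u k) (u j) (l k) (l j)) / 2 \<le> G (h k) (h j) (l k) (l j)"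
    if "j < n" for j
    unfolding h_def by (rule G_midpoint(1)) (use wp valid_in[OF l] k that in auto)
  have "?V \<le> cv l h"
  proof (rule charval_ge[OF l h])
    fix j assume j: "j < n" "j \<noteq> k"
    show "0 < h k + h j" using wp[OF k] wp[OF j(1)] by (simp add: h_def add_pos_pos)
    show "?V \<le> G (h k) (h j) (l k) (l j)"
      using Gh[OF j(1)] maximiser_G_ge[OF l w j] maximiser_G_ge[OF l u j] by simp
  qed
  then have hV: "cv l h = ?V" using charval_le_Tinv[OF l h] by simp
  have ratio: "w k * u j = u k * w j" if j: "j < n" for j
  proof (cases "j = k")
    case False
    show ?thesis
    proof (rule ccontr)
      assume "w k * u j \<noteq> u k * w j"
      moreover have "l k \<noteq> l j" using valid_less[OF l j False] by simp
      ultimately have "(G (w k) (w j) (l k) (l j) + G (u k) (u j) (l k) (l j)) / 2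
          < G (h k) (h j) (l k) (l j)"
        unfolding h_def by (intro G_midpoint(2)) (use wp valid_in[OF l] k j in auto)
      then show False
        using maximiser_G_ge[OF l w j False] maximiser_G_ge[OF l u j False]
          maximiser_tight[OF l h hV j False] by simp
    qed
  qed simp
  have "w k * (\<Sum>j<n. u j) = u k * (\<Sum>j<n. w j)"
    unfolding sum_distrib_left by (intro sum.cong) (use ratio in auto)
  then have "w k = u k" using w u by (simp add: prob_simplex_def)
  then show ?thesis using ratio[OF i] wp[OF k] by simp
qed

section \<open>Continuity of the optimal costs in the instance\<close>

lemma Tst_eq: "Tst l = 1 / Tinv l" by (simp add: Tstar_def)

text \<open>The limit points of \<open>wstar\<close> are maximisers by upper semicontinuity, so uniqueness
  turns this into continuity.\<close>
lemma allocation_continuous_seq: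
  assumes l: "valid l" "\<And>m. valid (ls m)" "\<And>i. i < n \<Longrightarrow> (\<lambda>m. ls m i) \<longlonglongrightarrow> l i"
  shows "\<exists>r. strict_mono r \<and>
    (\<forall>i<n. (\<lambda>m. Wst (ls (r m)) i * Tst (ls (r m))) \<longlonglongrightarrow> Wst l i * Tst l)"
proof -
  let ?V = "Tinv l"
  have k: "k < n" by (rule valid_k[OF l(1)])
  note W = wstar_maximises[OF l(1)]
  have Wp: "0 < Wst l i" if "i < n" for i by (rule maximiser_pos[OF l(1) W that])
  \<comment> \<open>Lower semicontinuity of the value: the weights optimal for \<open>l\<close> stay
    fixed while the instances vary, and the finitely many \<open>G\<close> constraints
    persist.\<close>
  have lower: "\<forall>\<^sub>F m in sequentially. v < Tinv (ls m)" if v: "v < ?V" for v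
  proof -
    obtain v' where v': "v < v'" "v' < ?V" using dense[OF v] by blast
    have "\<forall>\<^sub>F m in sequentially. \<forall>j\<in>{..<n} - {k}. v' < G (Wst l k) (Wst l j) (ls m k) (ls m j)"
    proof (intro eventually_ball_finite ballI)
      fix j assume "j \<in> {..<n} - {k}"
      then have j: "j < n" "j \<noteq> k" by auto
      have "(\<lambda>m. G (Wst l k) (Wst l j) (ls m k) (ls m j)) \<longlonglongrightarrow> G (Wst l k) (Wst l j) (l k) (l j)"
        by (rule tendsto_G) (use l j k Wp[OF k] Wp[OF j(1)] valid_in[OF l(1)] in auto)
      moreover have "v' < G (Wst l k) (Wst l j) (l k) (l j)"
        using v'(2) maximiser_G_ge[OF l(1) W j] by simp
      ultimately show "\<forall>\<^sub>F m in sequentially. v' < G (Wst l k) (Wst l j) (ls m k) (ls m j)"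
        by (rule order_tendstoD(1))
    qed simp
    then show ?thesis
    proof eventually_elim
      case (elim m)
      have "v' \<le> cv (ls m) (Wst l)"
        by (rule charval_ge[OF l(2) W(1)])
          (use elim Wp k in \<open>auto simp: less_imp_le add_pos_pos\<close>)
      then show ?case using charval_le_Tinv[OF l(2) W(1), of m] v'(1) by simp
    qed
  qed
  obtain r w where r: "strict_mono r" "\<forall>i<n. (\<lambda>m. Wst (ls (r m)) i) \<longlonglongrightarrow> w i"
    using finite_coordinates_convergent_subseq[of n "\<lambda>m. Wst (ls m)"]
      prob_simplex_coord[OF wstar_maximises(1)[OF l(2)]] by blast
  have w: "w \<in> prob_simplex n"
    by (rule prob_simplex_closed[of "\<lambda>m. Wst (ls (r m))"]) (use wstar_maximises(1)[OF l(2)] r in auto)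
  have lsr: "(\<lambda>m. ls (r m) i) \<longlonglongrightarrow> l i" if "i < n" for i
    using LIMSEQ_subseq_LIMSEQ[OF l(3)[OF that] r(1)] by (simp add: o_def)
  have limit_le: "v \<le> cv l w" if s: "strict_mono s" and v: "\<And>m. v \<le> Tinv (ls (r (s m)))" for v and s :: "nat \<Rightarrow> nat"
  proof (rule charval_upper_semicontinuous[OF l(1), of "\<lambda>m. ls (r (s m))" "\<lambda>m. Wst (ls (r (s m)))" _ "\<lambda>_. v"])
    show "(\<lambda>m. ls (r (s m)) i) \<longlonglongrightarrow> l i" "(\<lambda>m. Wst (ls (r (s m))) i) \<longlonglongrightarrow> w i" if "i < n" for i
      using LIMSEQ_subseq_LIMSEQ[OF lsr[OF that] s] LIMSEQ_subseq_LIMSEQ[OF r(2)[rule_format, OF that] s]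
      by (auto simp: o_def)
  qed (use l(2) wstar_maximises[OF l(2)] v in auto)
  \<comment> \<open>A bound that holds infinitely often along \<open>r\<close> holds everywhere
    along a further subsequence, with the same limit \<open>w\<close>.\<close>
  have limit_le': "v \<le> cv l w" if fr: "\<exists>\<^sub>F m in sequentially. v \<le> Tinv (ls (r m))" for v
  proof -
    have "infinite {m. v \<le> Tinv (ls (r m))}"
      using fr by (simp add: frequently_cofinite[symmetric] cofinite_eq_sequentially)
    from infinite_enumerate[OF this] obtain s :: "nat \<Rightarrow> nat"
      where "strict_mono s" "\<forall>m. s m \<in> {m. v \<le> Tinv (ls (r m))}" by blast
    then show ?thesis by (intro limit_le) auto
  qed
  have lower_r: "\<forall>\<^sub>F m in sequentially. v < Tinv (ls (r m))" if "v < ?V" for v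
    using lower[OF that] eventually_subseq[OF r(1)] by blast
  have "?V \<le> cv l w"
  proof (rule dense_le)
    fix v assume "v < ?V"
    have "\<forall>\<^sub>F m in sequentially. v \<le> Tinv (ls (r m))"
      by (rule eventually_mono[OF lower_r[OF \<open>v < ?V\<close>]]) simp
    then show "v \<le> cv l w"
      by (intro limit_le' eventually_frequently) auto
  qed
  then have wV: "cv l w = ?V" using charval_le_Tinv[OF l(1) w] by simp
  \<comment> \<open>From above: if the values were infinitely often at least some
    \<open>v > ?V\<close>, then \<open>v \<le> cv l w = ?V\<close>.\<close>
  have "(\<lambda>m. Tinv (ls (r m))) \<longlonglongrightarrow> ?V"
  proof (rule order_tendstoI)
    fix v assume v: "?V < v"
    show "\<forall>\<^sub>F m in sequentially. Tinv (ls (r m)) < v"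
      using limit_le'[of v] v wV unfolding frequently_def by (auto simp: not_le)
  qed (rule lower_r)
  moreover have "w i = Wst l i" if "i < n" for i
    by (rule maximiser_unique[OF l(1) w wV W that])
  ultimately have "(\<lambda>m. Wst (ls (r m)) i * Tst (ls (r m))) \<longlonglongrightarrow> Wst l i * Tst l" if "i < n" for i
    using r(2) that Tinv_pos[OF l(1)] unfolding Tst_eq by (intro tendsto_intros) auto
  then show ?thesis using r(1) by blast
qed

lemma valid_neighbourhood:
  assumes l: "valid l"
  obtains e where "e > 0" "\<And>l'. (\<And>i. i < n \<Longrightarrow> \<bar>l' i - l i\<bar> < e) \<Longrightarrow> valid l'"
proof -
  have k: "k < n" by (rule valid_k[OF l])
  \<comment> \<open>The gap must exceed \<open>2 * e\<close>, because arm \<open>i\<close> and arm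
    \<open>k\<close> may each move by nearly \<open>e\<close> towards each other.\<close>
  have ev: "\<forall>\<^sub>F e in at_right (0::real). \<forall>i\<in>{..<n}. (ball (l i) e \<subseteq> M) \<and> (i \<noteq> k \<longrightarrow> 2 * e < l k - l i)"
  proof (intro eventually_ball_finite ballI eventually_conj)
    fix i assume "i \<in> {..<n}"
    then have i: "i < n" by simp
    obtain d where d: "d > 0" "ball (l i) d \<subseteq> M"
      using open_M valid_in[OF l i] open_contains_ball by blast
    show "\<forall>\<^sub>F e in at_right 0. ball (l i) e \<subseteq> M"
      unfolding eventually_at_right_field by (intro exI[of _ d]) (use d in auto)
    show "\<forall>\<^sub>F e in at_right 0. i \<noteq> k \<longrightarrow> 2 * e < l k - l i"
      unfolding eventually_at_right_field
      by (intro exI[of _ "if i = k then 1 else (l k - l i) / 2"]) (use valid_less[OF l i] in auto)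
  qed simp
  obtain e where e: "e > 0" "\<And>i. i < n \<Longrightarrow> ball (l i) e \<subseteq> M"
    "\<And>i. i < n \<Longrightarrow> i \<noteq> k \<Longrightarrow> 2 * e < l k - l i"
    using eventually_happens'[OF _ eventually_conj[OF ev eventually_at_right_less[of 0]]]
    by (auto simp: trivial_limit_at_right_real)
  show thesis
  proof (rule that[OF e(1)])
    fix l' assume l': "\<And>i. i < n \<Longrightarrow> \<bar>l' i - l i\<bar> < e"
    have "l' i \<in> M" if "i < n" for i
      using e(2)[OF that] l'[OF that] by (auto simp: subset_iff dist_real_def)
    moreover have "l' i < l' k" if "i < n" "i \<noteq> k" for i
      using e(3)[OF that] l'[OF that(1)] l'[OF k] by linarith
    ultimately show "valid l'" using k by (simp add: valid_inst_def)
  qed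
qed

text \<open>By contradiction: counterexamples at distance below \<open>1 / (m + 1)\<close> converge
  to \<open>l\<close>, and convergence of the costs along a single subsequence already contradicts a
  persistent gap \<eta>.\<close>

lemma allocation_continuous:
  assumes l: "valid l" and "\<eta> > 0"
  obtains e where "e > 0"
    "\<And>l'. (\<And>i. i < n \<Longrightarrow> \<bar>l' i - l i\<bar> < e) \<Longrightarrow>
      valid l' \<and> (\<forall>i<n. \<bar>Wst l' i * Tst l' - Wst l i * Tst l\<bar> < \<eta>)"
proof -
  obtain e0 where e0: "e0 > 0" "\<And>l'. (\<And>i. i < n \<Longrightarrow> \<bar>l' i - l i\<bar> < e0) \<Longrightarrow> valid l'"
    using valid_neighbourhood[OF l] by blast
  have "\<exists>e>0. \<forall>l'. (\<forall>i<n. \<bar>l' i - l i\<bar> < e) \<longrightarrow>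
      valid l' \<and> (\<forall>i<n. \<bar>Wst l' i * Tst l' - Wst l i * Tst l\<bar> < \<eta>)"
  proof (rule ccontr)
    assume neg: "\<not> ?thesis"
    have "\<exists>l'. (\<forall>i<n. \<bar>l' i - l i\<bar> < min e0 (1 / real (Suc m))) \<and>
        \<not> (\<forall>i<n. \<bar>Wst l' i * Tst l' - Wst l i * Tst l\<bar> < \<eta>)" for m
    proof -
      have "min e0 (1 / real (Suc m)) > 0" using e0(1) by simp
      then obtain l' where l': "\<forall>i<n. \<bar>l' i - l i\<bar> < min e0 (1 / real (Suc m))"
        "\<not> (valid l' \<and> (\<forall>i<n. \<bar>Wst l' i * Tst l' - Wst l i * Tst l\<bar> < \<eta>))"
        using neg by blast
      moreover have "valid l'" using l'(1) by (intro e0(2)) auto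
      ultimately show ?thesis by blast
    qed
    then obtain ls where ls: "\<And>m i. i < n \<Longrightarrow> \<bar>ls m i - l i\<bar> < min e0 (1 / real (Suc m))"
      "\<And>m. \<not> (\<forall>i<n. \<bar>Wst (ls m) i * Tst (ls m) - Wst l i * Tst l\<bar> < \<eta>)"
      by metis
    have lim: "(\<lambda>m. ls m i) \<longlonglongrightarrow> l i" if "i < n" for i
    proof (rule LIMSEQ_I)
      fix r :: real assume "r > 0"
      then obtain N where N: "1 / real (Suc N) < r" using nat_approx_posE by blast
      have "norm (ls m i - l i) < r" if "m \<ge> N" for m
      proof -
        have "1 / real (Suc m) \<le> 1 / real (Suc N)" using that by (simp add: frac_le)
        then show ?thesis using ls(1)[OF \<open>i < n\<close>, of m] N by simp
      qed
      then show "\<exists>no. \<forall>m\<ge>no. norm (ls m i - l i) < r" by blast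
    qed
    have val: "valid (ls m)" for m by (rule e0(2)) (use ls(1) in auto)
    obtain r where r: "\<forall>i<n. (\<lambda>m. Wst (ls (r m)) i * Tst (ls (r m))) \<longlonglongrightarrow> Wst l i * Tst l"
      using allocation_continuous_seq[OF l val lim] by blast
    have "\<forall>\<^sub>F m in sequentially. \<forall>i\<in>{..<n}. \<bar>Wst (ls (r m)) i * Tst (ls (r m)) - Wst l i * Tst l\<bar> < \<eta>"
      using r \<open>\<eta> > 0\<close> by (intro eventually_ball_finite) (auto simp: tendsto_iff dist_real_def)
    then obtain m where "\<forall>i\<in>{..<n}. \<bar>Wst (ls (r m)) i * Tst (ls (r m)) - Wst l i * Tst l\<bar> < \<eta>"
      using eventually_happens'[OF sequentially_bot] by blast
    then show False using ls(2)[of "r m"] by auto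
  qed
  then show thesis using that by blast
qed

end

section \<open>Concentration of the empirical means\<close>

context exp_family
begin

lemma prob_space_member: "x \<in> M \<Longrightarrow> prob_space (member \<rho> \<Theta> x)"
  by (simp add: member_eq_tilted prob_space_tilted th_in)

lemma sets_member[measurable_cong]: "sets (member \<rho> \<Theta> x) = sets borel"
  by (simp add: member_eq_tilted sets_tilted)

lemma prob_space_sample:
  assumes "\<forall>i<n. \<mu> i \<in> M"
  shows "prob_space (sample_space \<rho> \<Theta> n \<mu>)"
  unfolding sample_space_def by (rule prob_space_PiM) (use assms prob_space_member in auto)

lemma measurable_sample:
  "i < n \<Longrightarrow> (\<lambda>X. X (i, s)) \<in> borel_measurable (sample_space \<rho> \<Theta> n \<mu>)"
proof -
  assume "i < n"
  then have "(\<lambda>X. X (i, s)) \<in> measurable (sample_space \<rho> \<Theta> n \<mu>) (member \<rho> \<Theta> (\<mu> i))"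
    unfolding sample_space_def
    using measurable_component_singleton[of "(i, s)" "{..<n} \<times> UNIV" "\<lambda>(i, s). member \<rho> \<Theta> (\<mu> i)"]
    by simp
  then show ?thesis by (simp cong: measurable_cong_sets add: sets_member)
qed

text \<open>The first \<open>m\<close> samples of arm \<open>i\<close> are extracted from the
  infinite product by reindexing \<open>t\<close> to \<open>(i, t)\<close>; on the resulting finite
  product the expectation factorises.\<close>

lemma mgf_sample_sum:
  assumes \<mu>: "\<forall>i<n. \<mu> i \<in> M" and i: "i < n" and s: "th (\<mu> i) + s \<in> \<Theta>"
  shows "(\<integral>\<^sup>+X. ennreal (exp (s * (\<Sum>t<m. X (i, t)))) \<partial>sample_space \<rho> \<Theta> n \<mu>)
    = ennreal (exp (b (th (\<mu> i) + s) - b (th (\<mu> i)))) ^ m"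
proof -
  define K where "K = {..<n} \<times> (UNIV :: nat set)"
  define Mf where "Mf = (\<lambda>(i, s :: nat). member \<rho> \<Theta> (\<mu> i))"
  define N where "N = (\<lambda>t :: nat. member \<rho> \<Theta> (\<mu> i))"
  have \<mu>i: "\<mu> i \<in> M" using \<mu> i by simp
  interpret N: prob_space "N t" for t unfolding N_def by (rule prob_space_member[OF \<mu>i])
  interpret product_sigma_finite N ..
  have distr: "distr (PiM K Mf) (PiM {..<m} N) (\<lambda>X. \<lambda>t\<in>{..<m}. X (i, t)) = PiM {..<m} N"
    using distr_PiM_reindex[of K Mf "\<lambda>t. (i, t)" "{..<m}"] \<mu> i prob_space_member
    by (auto simp: K_def Mf_def N_def inj_on_def)
  have meas: "(\<lambda>X. \<lambda>t\<in>{..<m}. X (i, t)) \<in> measurable (PiM K Mf) (PiM {..<m} N)"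
  proof (rule measurable_restrict)
    fix t show "(\<lambda>X. X (i, t)) \<in> measurable (PiM K Mf) (N t)"
      using measurable_component_singleton[of "(i, t)" K Mf] i by (simp add: K_def Mf_def N_def)
  qed
  have mN[measurable]: "(\<lambda>x. ennreal (exp (s * x))) \<in> borel_measurable (N t)" for t
    unfolding N_def by measurable
  have "(\<integral>\<^sup>+X. ennreal (exp (s * (\<Sum>t<m. X (i, t)))) \<partial>PiM K Mf)
      = (\<integral>\<^sup>+X. (\<Prod>t<m. ennreal (exp (s * (\<lambda>t\<in>{..<m}. X (i, t)) t))) \<partial>PiM K Mf)"
    by (intro nn_integral_cong) (simp add: prod_ennreal sum_distrib_left exp_sum)
  also have "\<dots> = (\<integral>\<^sup>+x. (\<Prod>t<m. ennreal (exp (s * x t))) \<partial>PiM {..<m} N)"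
    using nn_integral_distr[OF meas, of "\<lambda>x. \<Prod>t<m. ennreal (exp (s * x t))"]
    unfolding distr by simp
  also have "\<dots> = (\<Prod>t<m. \<integral>\<^sup>+x. ennreal (exp (s * x)) \<partial>N t)"
    by (rule product_nn_integral_prod) (simp, rule mN)
  also have "\<dots> = ennreal (exp (b (th (\<mu> i) + s) - b (th (\<mu> i)))) ^ m"
    unfolding N_def member_eq_tilted using nn_mgf_tilted[OF th_in[OF \<mu>i] s] by simp
  finally show ?thesis by (simp add: sample_space_def K_def Mf_def)
qed

text \<open>Markov's inequality for the exponential of \<open>s\<close> times the sum. Either sign
  of \<open>s\<close> is allowed, so one statement serves both tails.\<close>

lemma chernoff_bound:
  assumes \<mu>: "\<forall>i<n. \<mu> i \<in> M" and i: "i < n" and s: "th (\<mu> i) + s \<in> \<Theta>"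
  defines "P \<equiv> sample_space \<rho> \<Theta> n \<mu>"
  shows "emeasure P {X \<in> space P. real m * c \<le> s * (\<Sum>t<m. X (i, t))}
    \<le> ennreal (exp (b (th (\<mu> i) + s) - b (th (\<mu> i)) - c) ^ m)"
proof -
  have [measurable]: "(\<lambda>X. X (i, t)) \<in> borel_measurable P" for t
    unfolding P_def by (rule measurable_sample[OF i])
  have iff: "real m * c \<le> s * y \<longleftrightarrow> 1 \<le> ennreal (exp (- real m * c)) * ennreal (exp (s * y))" for y
    by (simp add: ennreal_mult[symmetric] exp_add[symmetric])
  have "emeasure P {X \<in> space P. real m * c \<le> s * (\<Sum>t<m. X (i, t))}
      \<le> ennreal (exp (- real m * c)) *
        (\<integral>\<^sup>+X. ennreal (exp (s * (\<Sum>t<m. X (i, t)))) * indicator (space P) X \<partial>P)"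
    unfolding iff by (rule nn_integral_Markov_inequality) auto
  also have "(\<integral>\<^sup>+X. ennreal (exp (s * (\<Sum>t<m. X (i, t)))) * indicator (space P) X \<partial>P)
      = (\<integral>\<^sup>+X. ennreal (exp (s * (\<Sum>t<m. X (i, t)))) \<partial>P)"
    by (intro nn_integral_cong) simp
  also have "\<dots> = ennreal (exp (b (th (\<mu> i) + s) - b (th (\<mu> i)))) ^ m"
    unfolding P_def by (rule mgf_sample_sum[OF \<mu> i s])
  also have "ennreal (exp (- real m * c)) * ennreal (exp (b (th (\<mu> i) + s) - b (th (\<mu> i)))) ^ m
      = ennreal (exp (b (th (\<mu> i) + s) - b (th (\<mu> i)) - c) ^ m)"
    by (simp add: ennreal_power ennreal_mult[symmetric] exp_of_nat_mult[symmetric]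
        exp_add[symmetric] algebra_simps)
  finally show ?thesis .
qed

text \<open>The derivative of \<open>b\<close> at \<open>th x\<close> is \<open>x\<close>, so for
  small \<open>s\<close> the difference quotients on both sides lie within \<xi> of
  \<open>x\<close>. The strict inequalities make both Chernoff exponents negative.\<close>

lemma tilt_exists:
  assumes x: "x \<in> M" and \<xi>: "\<xi> > 0"
  obtains s where "s > 0" "th x + s \<in> \<Theta>" "b (th x + s) - b (th x) < s * (x + \<xi>)"
    "th x + (- s) \<in> \<Theta>" "b (th x + (- s)) - b (th x) < (- s) * (x - \<xi>)"
proof -
  obtain e where e: "e > 0" "\<And>s. \<bar>s\<bar> < e \<Longrightarrow> th x + s \<in> \<Theta>"
    using ball_\<Theta>[OF th_in[OF x]] by blast
  have "(b has_real_derivative x) (at (th x))"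
    using DERIV_b[OF th_in[OF x]] deriv_th[OF x] by simp
  then have "((\<lambda>h. (b (th x + h) - b (th x)) / h) \<longlongrightarrow> x) (at 0)"
    by (simp add: DERIV_def)
  then have "\<forall>\<^sub>F h in at 0. dist ((b (th x + h) - b (th x)) / h) x < \<xi>"
    using \<xi> by (rule tendstoD)
  then obtain d where d: "d > 0"
    "\<And>h. h \<noteq> 0 \<Longrightarrow> \<bar>h\<bar> < d \<Longrightarrow> \<bar>(b (th x + h) - b (th x)) / h - x\<bar> < \<xi>"
    by (auto simp: eventually_at dist_real_def)
  define s where "s = min e d / 2"
  have s: "s > 0" "\<bar>s\<bar> < e" "\<bar>- s\<bar> < e" "\<bar>s\<bar> < d" "\<bar>- s\<bar> < d"
    using e d by (auto simp: s_def)
  show thesis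
  proof (rule that[OF s(1)])
    show "th x + s \<in> \<Theta>" "th x + (- s) \<in> \<Theta>" using e(2) s by blast+
    have "(b (th x + s) - b (th x)) / s < x + \<xi>" using d(2)[of s] s by auto
    then show "b (th x + s) - b (th x) < s * (x + \<xi>)" using s(1) by (simp add: field_simps)
    have "(b (th x + (- s)) - b (th x)) / (- s) > x - \<xi>" using d(2)[of "- s"] s(1,5) by auto
    then show "b (th x + (- s)) - b (th x) < (- s) * (x - \<xi>)" using s(1) by (simp add: field_simps)
  qed
qed

lemma sample_mean_deviation:
  assumes \<mu>: "\<forall>i<n. \<mu> i \<in> M" and i: "i < n" and \<xi>: "\<xi> > 0"
  defines "P \<equiv> sample_space \<rho> \<Theta> n \<mu>"
  shows "\<exists>r. 0 < r \<and> r < 1 \<and> (\<forall>m>0. emeasure P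
      {X \<in> space P. \<xi> \<le> \<bar>(\<Sum>t<m. X (i, t)) / real m - \<mu> i\<bar>} \<le> ennreal (2 * r ^ m))"
proof -
  let ?x = "\<mu> i"
  have x: "?x \<in> M" using \<mu> i by simp
  have [measurable]: "(\<lambda>X. X (i, t)) \<in> borel_measurable P" for t
    unfolding P_def by (rule measurable_sample[OF i])
  obtain s where s: "s > 0" "th ?x + s \<in> \<Theta>" "b (th ?x + s) - b (th ?x) < s * (?x + \<xi>)"
    "th ?x + (- s) \<in> \<Theta>" "b (th ?x + (- s)) - b (th ?x) < (- s) * (?x - \<xi>)"
    using tilt_exists[OF x \<xi>] by blast
  define r1 where "r1 = exp (b (th ?x + s) - b (th ?x) - s * (?x + \<xi>))"
  define r2 where "r2 = exp (b (th ?x + (- s)) - b (th ?x) - (- s) * (?x - \<xi>))"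
  have r: "0 < max r1 r2" "max r1 r2 < 1"
    using s by (auto simp: r1_def r2_def less_max_iff_disj)
  have "emeasure P {X \<in> space P. \<xi> \<le> \<bar>(\<Sum>t<m. X (i, t)) / real m - ?x\<bar>}
      \<le> ennreal (2 * max r1 r2 ^ m)" if m: "m > 0" for m
  proof -
    let ?S = "\<lambda>X :: nat \<times> nat \<Rightarrow> real. \<Sum>t<m. X (i, t)"
    let ?A = "{X \<in> space P. real m * (s * (?x + \<xi>)) \<le> s * ?S X}"
    let ?B = "{X \<in> space P. real m * ((- s) * (?x - \<xi>)) \<le> (- s) * ?S X}"
    have "emeasure P {X \<in> space P. \<xi> \<le> \<bar>?S X / real m - ?x\<bar>} \<le> emeasure P (?A \<union> ?B)"
    proof (rule emeasure_mono, rule subsetI)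
      fix X assume "X \<in> {X \<in> space P. \<xi> \<le> \<bar>?S X / real m - ?x\<bar>}"
      then have X: "X \<in> space P" "\<xi> \<le> \<bar>?S X / real m - ?x\<bar>" by auto
      then consider "?x + \<xi> \<le> ?S X / real m" | "?S X / real m \<le> ?x - \<xi>" by linarith
      then show "X \<in> ?A \<union> ?B"
      proof cases
        case 1
        then have "(?x + \<xi>) * real m \<le> ?S X" using m by (simp add: pos_le_divide_eq)
        then have "s * ((?x + \<xi>) * real m) \<le> s * ?S X" using s(1) by simp
        then show ?thesis using X(1) by (simp add: mult_ac)
      next
        case 2
        then have "?S X \<le> (?x - \<xi>) * real m" using m by (simp add: pos_divide_le_eq)
        then have "s * ?S X \<le> s * ((?x - \<xi>) * real m)" using s(1) by simp
        then show ?thesis using X(1) by (simp add: mult_ac)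
      qed
    qed measurable
    also have "\<dots> \<le> emeasure P ?A + emeasure P ?B"
      by (rule emeasure_subadditive) measurable
    also have "\<dots> \<le> ennreal (r1 ^ m) + ennreal (r2 ^ m)"
      unfolding r1_def r2_def P_def by (intro add_mono chernoff_bound[OF \<mu> i] s)
    also have "\<dots> = ennreal (r1 ^ m + r2 ^ m)"
      by (subst ennreal_plus) (auto simp: r1_def r2_def)
    also have "\<dots> \<le> ennreal (2 * max r1 r2 ^ m)"
    proof (rule ennreal_leI)
      have "r1 ^ m \<le> max r1 r2 ^ m" "r2 ^ m \<le> max r1 r2 ^ m"
        by (auto intro!: power_mono simp: r1_def r2_def)
      then show "r1 ^ m + r2 ^ m \<le> 2 * max r1 r2 ^ m" by simp
    qed
    finally show ?thesis .
  qed
  then show ?thesis using r by blast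
qed

text \<open>All sample sizes from \<open>m0\<close> on are controlled at once, so the bound can be
  applied at pull counts that depend on the data.\<close>

definition good :: "nat \<Rightarrow> (nat \<Rightarrow> real) \<Rightarrow> real \<Rightarrow> nat \<Rightarrow> (nat \<times> nat \<Rightarrow> real) set" where
  "good n \<mu> \<xi> m0 = {X. \<forall>i<n. \<forall>m\<ge>m0. \<bar>(\<Sum>t<m. X (i, t)) / real m - \<mu> i\<bar> < \<xi>}"

text \<open>A union bound over arms and over sample sizes from \<open>m0\<close> on; summing the
  geometric tail costs only the factor \<open>1 / (1 - r)\<close>.\<close>

lemma bad_event_prob:
  assumes \<mu>: "\<forall>i<n. \<mu> i \<in> M" and \<xi>: "\<xi> > 0"
  defines "P \<equiv> sample_space \<rho> \<Theta> n \<mu>"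
  obtains C r where "0 \<le> C" "0 < r" "r < 1"
    "\<And>m0. space P - good n \<mu> \<xi> m0 \<in> sets P"
    "\<And>m0. 0 < m0 \<Longrightarrow> emeasure P (space P - good n \<mu> \<xi> m0) \<le> ennreal (C * r ^ m0)"
proof -
  define A where "A i m = {X \<in> space P. \<xi> \<le> \<bar>(\<Sum>t<m. X (i, t)) / real m - \<mu> i\<bar>}" for i m
  have A[measurable]: "A i m \<in> sets P" if "i < n" for i m
  proof -
    have [measurable]: "(\<lambda>X. X (i, t)) \<in> borel_measurable P" for t
      unfolding P_def by (rule measurable_sample[OF that])
    show ?thesis unfolding A_def by measurable
  qed
  have eq: "space P - good n \<mu> \<xi> m0 = (\<Union>i\<in>{..<n}. \<Union>m. A i (m + m0))" for m0
  proof (rule set_eqI)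
    fix X
    have "(\<exists>m\<ge>m0. Q m) \<longleftrightarrow> (\<exists>m. Q (m + m0))" for Q
      by (metis le_add2 le_add_diff_inverse2)
    from this[of "\<lambda>m. X \<in> A i m" for i]
    have "(\<exists>i<n. \<exists>m\<ge>m0. X \<in> A i m) \<longleftrightarrow> X \<in> (\<Union>i\<in>{..<n}. \<Union>m. A i (m + m0))"
      by auto
    moreover have "(\<exists>i<n. \<exists>m\<ge>m0. X \<in> A i m) \<longleftrightarrow> X \<in> space P - good n \<mu> \<xi> m0"
      unfolding good_def A_def by (auto simp: not_less)
    ultimately show "X \<in> space P - good n \<mu> \<xi> m0 \<longleftrightarrow> X \<in> (\<Union>i\<in>{..<n}. \<Union>m. A i (m + m0))"
      by blast
  qed
  have "\<forall>i\<in>{..<n}. \<exists>r. 0 < r \<and> r < 1 \<and> (\<forall>m>0. emeasure P (A i m) \<le> ennreal (2 * r ^ m))"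
    using sample_mean_deviation[OF \<mu> _ \<xi>] unfolding A_def P_def by simp
  from bchoice[OF this] obtain r' where r': "\<And>i. i < n \<Longrightarrow> 0 < r' i" "\<And>i. i < n \<Longrightarrow> r' i < 1"
    "\<And>i m. i < n \<Longrightarrow> 0 < m \<Longrightarrow> emeasure P (A i m) \<le> ennreal (2 * r' i ^ m)"
    by auto
  \<comment> \<open>The entry \<open>1/2\<close> keeps the maximum over a non-empty set even for
    \<open>n = 0\<close>, and the rate inside (0, 1).\<close>
  define r where "r = Max (insert (1/2) (r' ` {..<n}))"
  have r: "0 < r" "r < 1"
    unfolding r_def using r' by (auto simp: Max_gr_iff Max_less_iff simp del: Max_insert)
  have r'r: "r' i \<le> r" if "i < n" for i unfolding r_def using that by (intro Max_ge) auto
  define C where "C = real n * (2 / (1 - r))"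
  show thesis
  proof (rule that[of C r])
    show "0 \<le> C" using r by (simp add: C_def)
    show "space P - good n \<mu> \<xi> m0 \<in> sets P" for m0
      unfolding eq by (intro sets.finite_UN sets.countable_UN) auto
    fix m0 :: nat assume m0: "0 < m0"
    have arm: "emeasure P (\<Union>m. A i (m + m0)) \<le> ennreal (2 / (1 - r) * r ^ m0)" if i: "i < n" for i
    proof -
      have "emeasure P (\<Union>m. A i (m + m0)) \<le> (\<Sum>m. emeasure P (A i (m + m0)))"
        by (intro emeasure_subadditive_countably) (use A[OF i] in auto)
      also have "\<dots> \<le> (\<Sum>m. ennreal (2 * r ^ m0 * r ^ m))"
      proof (intro suminf_le summableI)
        fix m
        have "emeasure P (A i (m + m0)) \<le> ennreal (2 * r' i ^ (m + m0))"
          using r'(3)[OF i] m0 by simp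
        also have "\<dots> \<le> ennreal (2 * r ^ m0 * r ^ m)"
          using power_mono[OF r'r[OF i] less_imp_le[OF r'(1)[OF i]], of "m + m0"]
          by (intro ennreal_leI) (simp add: power_add mult_ac)
        finally show "emeasure P (A i (m + m0)) \<le> ennreal (2 * r ^ m0 * r ^ m)" .
      qed
      also have "\<dots> = ennreal (\<Sum>m. 2 * r ^ m0 * r ^ m)"
        by (rule suminf_ennreal2) (use r in \<open>auto intro!: summable_mult summable_geometric\<close>)
      also have "(\<Sum>m. 2 * r ^ m0 * r ^ m) = 2 * r ^ m0 * (1 / (1 - r))"
        using r by (subst suminf_mult) (auto simp: suminf_geometric summable_geometric)
      finally show ?thesis by (simp add: mult_ac)
    qed
    have "emeasure P (space P - good n \<mu> \<xi> m0) \<le> (\<Sum>i\<in>{..<n}. emeasure P (\<Union>m. A i (m + m0)))"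
      unfolding eq by (intro emeasure_subadditive_finite) auto
    also have "\<dots> \<le> (\<Sum>i\<in>{..<n}. ennreal (2 / (1 - r) * r ^ m0))"
      by (intro sum_mono arm) simp
    also have "\<dots> = ennreal (C * r ^ m0)"
      using r by (simp add: C_def ennreal_of_nat_eq_real_of_nat ennreal_mult[symmetric] mult_ac)
    finally show "emeasure P (space P - good n \<mu> \<xi> m0) \<le> ennreal (C * r ^ m0)" .
  qed (use r in auto)
qed

end

section \<open>Runs of the algorithm\<close>

lemma nat_ceiling_ge: "x \<le> real (nat \<lceil>x\<rceil>)"
  by linarith

lemma nat_ceiling_le: "0 \<le> x \<Longrightarrow> real (nat \<lceil>x\<rceil>) \<le> x + 1"
  by linarith

text \<open>Batches telescope: the pulls added when the running maximum grows are exactly the growth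
  of its ceiling.\<close>

lemma stage2_counts:
  assumes "0 \<le> L1" "i < n"
  shows "L1 \<le> fst (snd (stage2 \<rho> \<Theta> n \<delta> \<epsilon> L1 L2 \<alpha> X q)) i"
    and "fst (stage2 \<rho> \<Theta> n \<delta> \<epsilon> L1 L2 \<alpha> X q) i
      = nat \<lceil>fst (snd (stage2 \<rho> \<Theta> n \<delta> \<epsilon> L1 L2 \<alpha> X q)) i\<rceil>"
proof -
  have ceil: "nat \<lceil>x\<rceil> + nat (\<lceil>y\<rceil> - \<lceil>x\<rceil>) = nat \<lceil>max x y\<rceil>" if "0 \<le> x" for x y :: real
    using that by (cases "x \<le> y") (auto simp: max_def nat_add_distrib[symmetric] ceiling_mono)
  have "L1 \<le> fst (snd (stage2 \<rho> \<Theta> n \<delta> \<epsilon> L1 L2 \<alpha> X q)) i \<and>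
    fst (stage2 \<rho> \<Theta> n \<delta> \<epsilon> L1 L2 \<alpha> X q) i
      = nat \<lceil>fst (snd (stage2 \<rho> \<Theta> n \<delta> \<epsilon> L1 L2 \<alpha> X q)) i\<rceil>"
  proof (induction q)
    case (Suc q)
    then show ?case
      using assms by (auto simp: Let_def ceil split: prod.splits)
  qed (use assms in auto)
  then show "L1 \<le> fst (snd (stage2 \<rho> \<Theta> n \<delta> \<epsilon> L1 L2 \<alpha> X q)) i"
    "fst (stage2 \<rho> \<Theta> n \<delta> \<epsilon> L1 L2 \<alpha> X q) i
      = nat \<lceil>fst (snd (stage2 \<rho> \<Theta> n \<delta> \<epsilon> L1 L2 \<alpha> X q)) i\<rceil>" by auto
qed

lemma stage2_counts_ge:
  assumes "0 \<le> L1" "i < n"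
  shows "L1 \<le> real (fst (stage2 \<rho> \<Theta> n \<delta> \<epsilon> L1 L2 \<alpha> X q) i)"
  using stage2_counts[OF assms, where q = q]
    nat_ceiling_ge[of "fst (snd (stage2 \<rho> \<Theta> n \<delta> \<epsilon> L1 L2 \<alpha> X q)) i" for \<rho> \<Theta> \<delta> \<epsilon> L2 \<alpha> X]
  by (metis order_trans)

text \<open>The bound on the targets is assumed for every count vector that has passed Stage I,
  hence applies in whichever states the data produce and after any number of iterations.\<close>

lemma stage2_upper:
  assumes "0 \<le> L1" "i < n" "L1 \<le> U"
    and "\<And>N. (\<And>j. j < n \<Longrightarrow> L1 \<le> real (N j)) \<Longrightarrow>
      Tq \<rho> \<Theta> n \<delta> L2 \<alpha> (empbest n X N) (bvec n \<epsilon> X N) i \<le> U"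
  shows "fst (snd (stage2 \<rho> \<Theta> n \<delta> \<epsilon> L1 L2 \<alpha> X q)) i \<le> U"
proof (induction q)
  case (Suc q)
  have "Tq \<rho> \<Theta> n \<delta> L2 \<alpha> (empbest n X N) (bvec n \<epsilon> X N) i \<le> U"
    if "N = fst (stage2 \<rho> \<Theta> n \<delta> \<epsilon> L1 L2 \<alpha> X q)" for N
    unfolding that by (intro assms(4) stage2_counts_ge[OF assms(1)])
  then show ?case
    using Suc by (auto simp: Let_def split: prod.splits)
qed (use assms in auto)

lemma stage2_lower:
  assumes "0 \<le> L1" "i < n" "0 < q"
    and "\<And>N. (\<And>j. j < n \<Longrightarrow> L1 \<le> real (N j)) \<Longrightarrow>
      B \<le> Tq \<rho> \<Theta> n \<delta> L2 \<alpha> (empbest n X N) (bvec n \<epsilon> X N) i"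
  shows "B \<le> fst (snd (stage2 \<rho> \<Theta> n \<delta> \<epsilon> L1 L2 \<alpha> X q)) i"
proof -
  \<comment> \<open>The claim is strengthened by the stop flag: it starts false, so a frozen state
    has already completed an iteration with target at least \<open>B\<close>.\<close>
  have "(0 < q \<or> snd (snd (snd (stage2 \<rho> \<Theta> n \<delta> \<epsilon> L1 L2 \<alpha> X q)))) \<longrightarrow>
    B \<le> fst (snd (stage2 \<rho> \<Theta> n \<delta> \<epsilon> L1 L2 \<alpha> X q)) i"
  proof (induction q)
    case (Suc q)
    have "B \<le> Tq \<rho> \<Theta> n \<delta> L2 \<alpha> (empbest n X N) (bvec n \<epsilon> X N) i"
      if "N = fst (stage2 \<rho> \<Theta> n \<delta> \<epsilon> L1 L2 \<alpha> X q)" for N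
      unfolding that by (intro assms(4) stage2_counts_ge[OF assms(1)])
    then show ?case
      using Suc by (auto simp: Let_def le_max_iff_disj split: prod.splits)
  qed auto
  then show ?thesis using assms(3) by blast
qed

text \<open>A bound for every sample table: Stage II targets are capped by \<open>L2\<close>, and
  Stage IV tops each arm up to \<open>L3\<close>. It prices a failure of concentration.\<close>

lemma pulls_le:
  assumes "0 \<le> L1" "0 \<le> L2" "0 \<le> L3"
  shows "real (tribbai_pulls \<rho> \<Theta> n \<delta> \<epsilon> L1 L2 L3 \<alpha> \<beta> X) \<le> real n * (L1 + L2 + L3 + 2)"
proof -
  define N where "N = fst (stage2 \<rho> \<Theta> n \<delta> \<epsilon> L1 L2 \<alpha> X (nat \<lceil>ln (1 / \<delta>)\<rceil>))"
  have N: "real (N i) \<le> L1 + L2 + 1" if "i < n" for i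
  proof -
    let ?T = "fst (snd (stage2 \<rho> \<Theta> n \<delta> \<epsilon> L1 L2 \<alpha> X (nat \<lceil>ln (1 / \<delta>)\<rceil>))) i"
    have "?T \<le> L1 + L2"
      by (rule stage2_upper) (use assms that in \<open>auto simp: Tq_def min_def\<close>)
    moreover have "0 \<le> ?T" using stage2_counts(1)[OF assms(1) that] assms(1) order_trans by blast
    moreover have "N i = nat \<lceil>?T\<rceil>" unfolding N_def by (rule stage2_counts(2)[OF assms(1) that])
    ultimately show ?thesis using nat_ceiling_le[of ?T] by linarith
  qed
  have max: "real (max (N i) (nat \<lceil>L3\<rceil>)) \<le> L1 + L2 + L3 + 2" if "i < n" for i
    unfolding of_nat_max
    by (rule max.boundedI) (use N[OF that] nat_ceiling_le[OF assms(3)] assms in linarith)+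
  have "tribbai_pulls \<rho> \<Theta> n \<delta> \<epsilon> L1 L2 L3 \<alpha> \<beta> X \<le> (\<Sum>i<n. max (N i) (nat \<lceil>L3\<rceil>))"
    unfolding tribbai_pulls_def Let_def N_def[symmetric] by (auto intro!: sum_mono)
  then have "real (tribbai_pulls \<rho> \<Theta> n \<delta> \<epsilon> L1 L2 L3 \<alpha> \<beta> X) \<le> (\<Sum>i<n. real (max (N i) (nat \<lceil>L3\<rceil>)))"
    by (metis of_nat_le_iff of_nat_sum)
  also have "\<dots> \<le> (\<Sum>i<n. L1 + L2 + L3 + 2)" by (intro sum_mono max) simp
  finally show ?thesis by simp
qed

section \<open>The stopping statistic and runs on the good event\<close>

context exp_family
begin

text \<open>Joint continuity of \<open>G\<close>, with one radius \<open>h\<close> serving the loss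
  \<eta> in the weights and the errors of both means.\<close>

lemma G_perturb:
  assumes "0 < a" "0 < c" "x0 \<in> M" "z0 \<in> M" "v < G a c x0 z0"
  obtains h where "h > 0"
    "\<And>\<eta> x z. \<bar>\<eta>\<bar> < h \<Longrightarrow> \<bar>x - x0\<bar> < h \<Longrightarrow> \<bar>z - z0\<bar> < h \<Longrightarrow> v < G (a - \<eta>) (c - \<eta>) x z"
proof -
  let ?F = "nhds (0::real) \<times>\<^sub>F (nhds x0 \<times>\<^sub>F nhds z0)"
  have lim1: "(fst \<longlongrightarrow> 0) ?F" by (rule filterlim_fst)
  have lim2: "((\<lambda>p. fst (snd p)) \<longlongrightarrow> x0) ?F"
    by (rule filterlim_compose[OF filterlim_fst filterlim_snd])
  have lim3: "((\<lambda>p. snd (snd p)) \<longlongrightarrow> z0) ?F"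
    by (rule filterlim_compose[OF filterlim_snd filterlim_snd])
  have "((\<lambda>p. G (a - fst p) (c - fst p) (fst (snd p)) (snd (snd p))) \<longlongrightarrow> G a c x0 z0) ?F"
  proof (rule tendsto_G[OF _ _ lim2 lim3])
    show "((\<lambda>p. a - fst p) \<longlongrightarrow> a) ?F" "((\<lambda>p. c - fst p) \<longlongrightarrow> c) ?F"
      using tendsto_diff[OF tendsto_const lim1, of a] tendsto_diff[OF tendsto_const lim1, of c] by simp_all
  qed (use assms in auto)
  from order_tendstoD(1)[OF this assms(5)] obtain P Q R where
    ev: "eventually P (nhds 0)" "eventually Q (nhds x0)" "eventually R (nhds z0)"
    and PQR: "\<And>\<eta> x z. P \<eta> \<Longrightarrow> Q x \<Longrightarrow> R z \<Longrightarrow> v < G (a - \<eta>) (c - \<eta>) x z"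
    unfolding eventually_prod_filter by (metis fst_conv snd_conv)
  obtain p q r where pqr: "p > 0" "q > 0" "r > 0" "\<And>\<eta>. \<bar>\<eta>\<bar> < p \<Longrightarrow> P \<eta>"
    "\<And>x. \<bar>x - x0\<bar> < q \<Longrightarrow> Q x" "\<And>z. \<bar>z - z0\<bar> < r \<Longrightarrow> R z"
    using ev by (auto simp: eventually_nhds_metric dist_real_def)
  show thesis
    by (rule that[of "min p (min q r)"]) (use pqr PQR in auto)
qed

text \<open>Means inside \<open>M\<close>, together with their pooled mean, bring the extended
  divergence back to \<open>D\<close>.\<close>

lemma Zstat_eq_G:
  assumes "empmean X N i \<in> M" "empmean X N j \<in> M" "0 < N i" "0 < N j"
  shows "Zstat \<rho> \<Theta> X N i j = ereal (G (real (N i)) (real (N j)) (empmean X N i) (empmean X N j))"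
proof -
  let ?w = "wmean (real (N i)) (real (N j)) (empmean X N i) (empmean X N j)"
  have w: "?w \<in> M" using assms by (intro wmean_in) auto
  have "klext \<rho> \<Theta> u ?w = ereal (D u ?w)" if "u \<in> M" for u
    using that w by (simp add: klext_def kl_eq_D)
  then show ?thesis
    using assms by (simp add: Zstat_def Let_def G_def wmean_def)
qed

end

lemma (in bandit) empbest_valid:
  assumes "valid (empmean X N)" and k0: "k = 0"
  shows "empbest n X N = 0"
  unfolding empbest_def
proof (rule Least_equality)
  show "0 < n \<and> (\<forall>j<n. empmean X N j \<le> empmean X N 0)"
    using n2 valid_less[OF assms(1)] k0 by (metis gr0I le_numeral_extra(2) le_zero_eq less_imp_le order_refl zero_neq_numeral)
qed simp

text \<open>The deterministic facts about one run on the good event: \<eta> is the tolerance of the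
  costs, \<open>e\<close> the matching radius of instances, \<xi> the error of the means. The last
  two assumptions keep the cap \<open>L2\<close> above the lower targets and Stage I below the upper
  ones.\<close>

locale good_run = bandit \<rho> \<Theta> n 0 for \<rho> \<Theta> n +
  fixes \<mu> :: "nat \<Rightarrow> real" and \<eta> e \<xi> \<epsilon> \<alpha> \<delta> L1 L2 :: real
    and X :: "nat \<times> nat \<Rightarrow> real"
  assumes near: "\<And>l. (\<And>i. i < n \<Longrightarrow> \<bar>l i - \<mu> i\<bar> < e) \<Longrightarrow>
      valid l \<and> (\<forall>i<n. \<bar>Wst l i * Tst l - Wst \<mu> i * Tst \<mu>\<bar> < \<eta>)"
    and X: "X \<in> good n \<mu> \<xi> (nat \<lceil>L1\<rceil>)"
    and \<epsilon>: "0 < \<epsilon>" "\<xi> + \<epsilon> \<le> e"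
    and \<alpha>: "0 < \<alpha>" and \<delta>: "0 < ln (1 / \<delta>)" and L1: "0 < L1"
    and L2: "\<And>i. i < n \<Longrightarrow> \<alpha> * (Wst \<mu> i * Tst \<mu> - \<eta>) * ln (1 / \<delta>) \<le> L2"
    and L1_le: "\<And>i. i < n \<Longrightarrow> L1 \<le> \<alpha> * (Wst \<mu> i * Tst \<mu> + \<eta>) * ln (1 / \<delta>)"
begin

abbreviation "cost i \<equiv> Wst \<mu> i * Tst \<mu>"

lemma empmean_near:
  assumes "i < n" "L1 \<le> real (N i)"
  shows "\<bar>empmean X N i - \<mu> i\<bar> < \<xi>"
proof -
  have "nat \<lceil>L1\<rceil> \<le> N i" using assms(2) by linarith
  then show ?thesis using X assms(1) by (simp add: good_def empmean_def)
qed

lemma empmean_valid: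
  assumes "\<And>i. i < n \<Longrightarrow> L1 \<le> real (N i)"
  shows "valid (empmean X N)"
  using near[of "empmean X N"] empmean_near[of _ N] assms \<epsilon> by force

lemma empbest_eq:
  assumes "\<And>i. i < n \<Longrightarrow> L1 \<le> real (N i)"
  shows "empbest n X N = 0"
  by (rule empbest_valid[OF empmean_valid[OF assms] refl])

lemma Tq_bounds:
  assumes N: "\<And>i. i < n \<Longrightarrow> L1 \<le> real (N i)" and i: "i < n"
  defines "T \<equiv> Tq \<rho> \<Theta> n \<delta> L2 \<alpha> (empbest n X N) (bvec n \<epsilon> X N) i"
  shows "\<alpha> * (cost i - \<eta>) * ln (1 / \<delta>) \<le> T" "T \<le> \<alpha> * (cost i + \<eta>) * ln (1 / \<delta>)"
proof -
  let ?l = "bvec n \<epsilon> X N"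
  \<comment> \<open>The empirical error and the shift by \<epsilon> together stay below
    \<open>e\<close>.\<close>
  have "\<bar>?l j - \<mu> j\<bar> < e" if "j < n" for j
    using empmean_near[OF that, of N] N[OF that] \<epsilon> by (auto simp: bvec_def)
  from near[of ?l, OF this] have l: "valid ?l" "\<bar>Wst ?l i * Tst ?l - cost i\<bar> < \<eta>" using i by auto
  have T: "T = min (\<alpha> * (Wst ?l i * Tst ?l) * ln (1 / \<delta>)) L2"
    using l(1) empbest_eq[of N] N unfolding T_def by (simp add: Tq_def mult.assoc)
  have "\<alpha> * (cost i - \<eta>) * ln (1 / \<delta>) \<le> \<alpha> * (Wst ?l i * Tst ?l) * ln (1 / \<delta>)"
    "\<alpha> * (Wst ?l i * Tst ?l) * ln (1 / \<delta>) \<le> \<alpha> * (cost i + \<eta>) * ln (1 / \<delta>)"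
    using l(2) \<alpha> \<delta> by (auto intro!: mult_right_mono mult_left_mono simp del: ln_inverse)
  then show "\<alpha> * (cost i - \<eta>) * ln (1 / \<delta>) \<le> T" "T \<le> \<alpha> * (cost i + \<eta>) * ln (1 / \<delta>)"
    using L2[OF i] unfolding T by (auto simp: min_le_iff_disj)
qed

definition N where "N = fst (stage2 \<rho> \<Theta> n \<delta> \<epsilon> L1 L2 \<alpha> X (nat \<lceil>ln (1 / \<delta>)\<rceil>))"

lemma N_ge_L1: "i < n \<Longrightarrow> L1 \<le> real (N i)"
  unfolding N_def by (rule stage2_counts_ge) (use L1 in auto)

lemma N_bounds:
  assumes i: "i < n"
  shows "\<alpha> * (cost i - \<eta>) * ln (1 / \<delta>) \<le> real (N i)"
    "real (N i) \<le> \<alpha> * (cost i + \<eta>) * ln (1 / \<delta>) + 1"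
proof -
  let ?T = "fst (snd (stage2 \<rho> \<Theta> n \<delta> \<epsilon> L1 L2 \<alpha> X (nat \<lceil>ln (1 / \<delta>)\<rceil>))) i"
  have L0: "0 \<le> L1" using L1 by simp
  have T: "L1 \<le> ?T" "N i = nat \<lceil>?T\<rceil>"
    unfolding N_def using stage2_counts[OF L0 i] by blast+
  have "?T \<le> \<alpha> * (cost i + \<eta>) * ln (1 / \<delta>)"
    by (rule stage2_upper[OF L0 i L1_le[OF i]]) (rule Tq_bounds(2)[OF _ i])
  then show "real (N i) \<le> \<alpha> * (cost i + \<eta>) * ln (1 / \<delta>) + 1"
    using T nat_ceiling_le[of ?T] L0 by linarith
  \<comment> \<open>At least one Stage II iteration is scheduled, so the lower bound on the targets
    reaches the counts.\<close>
  have "0 < nat \<lceil>ln (1 / \<delta>)\<rceil>" using \<delta> by linarith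
  from stage2_lower[OF L0 i this Tq_bounds(1)[OF _ i]]
  have "\<alpha> * (cost i - \<eta>) * ln (1 / \<delta>) \<le> ?T" by blast
  then show "\<alpha> * (cost i - \<eta>) * ln (1 / \<delta>) \<le> real (N i)"
    using T(2) nat_ceiling_ge[of ?T] by simp
qed

text \<open>The weights sum to 1, so the costs sum to \<open>Tst \<mu>\<close>; the ceilings add at
  most one pull per arm.\<close>

lemma sum_N_le:
  assumes "valid \<mu>"
  shows "real (\<Sum>i<n. N i) \<le> \<alpha> * (Tst \<mu> + real n * \<eta>) * ln (1 / \<delta>) + real n"
proof -
  have "real (\<Sum>i<n. N i) \<le> (\<Sum>i<n. \<alpha> * (cost i + \<eta>) * ln (1 / \<delta>) + 1)"
    unfolding of_nat_sum by (intro sum_mono N_bounds) simp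
  also have "\<dots> = \<alpha> * ((\<Sum>i<n. Wst \<mu> i) * Tst \<mu> + real n * \<eta>) * ln (1 / \<delta>) + real n"
    by (simp add: sum.distrib sum_distrib_left[symmetric] sum_distrib_right[symmetric])
  finally show ?thesis
    using wstar_maximises(1)[OF assms] by (simp add: prob_simplex_def)
qed

text \<open>The counts dominate \<open>\<alpha> * ln (1 / \<delta>)\<close> times the reduced costs,
  so homogeneity and monotonicity of \<open>G\<close> bound the statistic below by that factor times
  \<open>v\<close>.\<close>

lemma stage3_stops:
  assumes \<eta>: "\<And>i. i < n \<Longrightarrow> \<eta> < cost i"
    and v: "\<And>j. 0 < j \<Longrightarrow> j < n \<Longrightarrow> v \<le> G (cost 0 - \<eta>) (cost j - \<eta>) (empmean X N 0) (empmean X N j)"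
    and \<beta>: "\<beta> (real (\<Sum>i<n. N i)) (\<delta> / 2) \<le> \<alpha> * ln (1 / \<delta>) * v"
  shows "tribbai_pulls \<rho> \<Theta> n \<delta> \<epsilon> L1 L2 L3 \<alpha> \<beta> X = (\<Sum>i<n. N i)"
proof -
  have k: "empbest n X N = 0" by (rule empbest_eq[OF N_ge_L1])
  have "ereal (\<beta> (real (\<Sum>i<n. N i)) (\<delta> / 2)) \<le> Zstat \<rho> \<Theta> X N 0 j" if j: "j < n" "j \<noteq> 0" for j
  proof -
    let ?s = "\<alpha> * ln (1 / \<delta>)"
    let ?x = "empmean X N 0" and ?z = "empmean X N j"
    have s: "0 < ?s" using \<alpha> \<delta> by simp
    have n0: "0 < n" using n2 by simp
    have M: "?x \<in> M" "?z \<in> M"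
      using valid_in[OF empmean_valid[OF N_ge_L1]] n0 j by auto
    have Npos: "0 < N i" if "i < n" for i using N_ge_L1[OF that] L1 by linarith
    have "?s * v \<le> ?s * G (cost 0 - \<eta>) (cost j - \<eta>) ?x ?z"
      using v[of j] j s by (intro mult_left_mono) auto
    also have "\<dots> = G (?s * (cost 0 - \<eta>)) (?s * (cost j - \<eta>)) ?x ?z"
      using s by (subst G_scale) auto
    also have "\<dots> \<le> G (real (N 0)) (real (N j)) ?x ?z"
    proof (rule G_mono)
      show "?s * (cost 0 - \<eta>) \<le> real (N 0)" "?s * (cost j - \<eta>) \<le> real (N j)"
        using N_bounds(1)[OF n0] N_bounds(1)[OF j(1)] by (simp_all add: mult_ac)
      have "0 < ?s * (cost 0 - \<eta>)" "0 < ?s * (cost j - \<eta>)"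
        using s \<eta>[OF n0] \<eta>[OF j(1)] by (auto intro!: mult_pos_pos)
      then show "0 \<le> ?s * (cost 0 - \<eta>)" "0 \<le> ?s * (cost j - \<eta>)"
        "0 < ?s * (cost 0 - \<eta>) + ?s * (cost j - \<eta>)" by linarith+
    qed (use M in auto)
    finally show ?thesis
      using \<beta> Zstat_eq_G[OF M Npos[OF n0] Npos[OF j(1)]] by simp
  qed
  then show ?thesis
    unfolding tribbai_pulls_def Let_def N_def[symmetric] k by simp
qed

end

section \<open>Expected number of pulls\<close>

lemma threshold_eq:
  fixes \<delta> t \<alpha> :: real
  assumes "0 < \<delta>" "0 < t" "0 < ln (1 / \<delta>)"
  shows "ln (ln (1 / (\<delta> / 2)) * t powr \<alpha> / (\<delta> / 2))
    = ln (ln 2 + ln (1 / \<delta>)) + \<alpha> * ln t + ln 2 + ln (1 / \<delta>)"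
proof -
  have ln2: "ln (1 / (\<delta> / 2)) = ln 2 + ln (1 / \<delta>)"
    using ln_mult[of 2 "1 / \<delta>"] assms(1) by simp
  have split: "ln (A * t powr \<alpha> * 2 * E) = ln A + \<alpha> * ln t + ln 2 + ln E"
    if "0 < A" "0 < E" for A E :: real
    using that assms(2) by (simp add: ln_mult ln_powr)
  have "ln ((ln 2 + ln (1 / \<delta>)) * t powr \<alpha> * 2 * (1 / \<delta>))
      = ln (ln 2 + ln (1 / \<delta>)) + \<alpha> * ln t + ln 2 + ln (1 / \<delta>)"
    using assms(1,3) by (intro split) (auto intro: add_pos_pos)
  with ln2 show ?thesis by simp
qed

lemma filterlim_ln_inverse_at_right: "filterlim (\<lambda>\<delta>::real. ln (1 / \<delta>)) at_top (at_right 0)"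
  by real_asymp

text \<open>After at most \<open>K * L\<close> pulls the threshold exceeds \<open>L\<close> only by
  a logarithmic amount, which any fixed fraction \<kappa> of \<open>L\<close> absorbs.\<close>

lemma threshold_eventually:
  fixes \<alpha> K \<kappa> :: real
  assumes "0 < \<kappa>"
  shows "\<forall>\<^sub>F L in at_top. ln (ln 2 + L) + \<alpha> * (ln K + ln L) + ln 2 + L \<le> (1 + \<kappa>) * L"
proof -
  have "((\<lambda>L. (ln (ln 2 + L) + \<alpha> * (ln K + ln L) + ln 2) / L) \<longlongrightarrow> 0) at_top"
  proof -
    have "((\<lambda>L::real. ln (ln 2 + L) / L) \<longlongrightarrow> 0) at_top" "((\<lambda>L::real. ln L / L) \<longlongrightarrow> 0) at_top"
      "((\<lambda>L::real. 1 / L) \<longlongrightarrow> 0) at_top"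
      by real_asymp+
    then have "((\<lambda>L. ln (ln 2 + L) / L + \<alpha> * (ln L / L) + (\<alpha> * ln K + ln 2) * (1 / L))
        \<longlongrightarrow> 0 + \<alpha> * 0 + (\<alpha> * ln K + ln 2) * 0) at_top"
      by (intro tendsto_intros)
    then show ?thesis by (simp add: add_divide_distrib algebra_simps)
  qed
  then have "\<forall>\<^sub>F L in at_top. (ln (ln 2 + L) + \<alpha> * (ln K + ln L) + ln 2) / L < \<kappa>"
    using assms by (rule order_tendstoD(2))
  then show ?thesis
    using eventually_gt_at_top[of 0]
    by eventually_elim (simp add: pos_divide_less_eq algebra_simps)
qed

text \<open>The worst case is quadratic in \<open>L\<close>, while \<open>exp (- p * sqrt L)\<close>
  decays faster than any power of \<open>L\<close>; only the slope \<open>a\<close> survives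
  division by \<open>L\<close>.\<close>

lemma failure_cost_vanishes:
  fixes p C m :: real
  assumes "0 < p" "0 < m"
  shows "((\<lambda>L. (a * L + m + m * (sqrt L + L * ln L / m + L\<^sup>2 + 2) * (C * exp (- p * sqrt L))) / L)
    \<longlongrightarrow> a) at_top"
proof -
  have 1: "((\<lambda>L. (sqrt L + L * ln L / m + L\<^sup>2 + 2) * exp (- p * sqrt L) / L) \<longlongrightarrow> 0) at_top"
    using assms by real_asymp
  have 2: "((\<lambda>L::real. 1 / L) \<longlongrightarrow> 0) at_top" by real_asymp
  have "((\<lambda>L. a + m * (1 / L)
      + m * C * ((sqrt L + L * ln L / m + L\<^sup>2 + 2) * exp (- p * sqrt L) / L))
    \<longlongrightarrow> a + m * 0 + m * C * 0) at_top"
    by (intro tendsto_intros 1 2)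
  then have lim: "((\<lambda>L. a + m * (1 / L)
      + m * C * ((sqrt L + L * ln L / m + L\<^sup>2 + 2) * exp (- p * sqrt L) / L)) \<longlongrightarrow> a) at_top"
    by simp
  show ?thesis
    by (rule Lim_transform_eventually[OF lim], rule eventually_mono[OF eventually_gt_at_top[of 0]])
      (simp add: add_divide_distrib mult_ac)
qed

text \<open>The integrand is dominated pointwise by \<open>u\<close> plus \<open>v\<close> times the
  indicator of \<open>B\<close>; only this measurable majorant is integrated exactly.\<close>

lemma nn_integral_le_good_bad:
  assumes "prob_space P" "B \<in> sets P" "0 \<le> u" "0 \<le> v" "0 \<le> p"
    and "\<And>x. x \<in> space P \<Longrightarrow> x \<notin> B \<Longrightarrow> real (f x) \<le> u" "\<And>x. real (f x) \<le> v"
    and "emeasure P B \<le> ennreal p"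
  shows "(\<integral>\<^sup>+x. of_nat (f x) \<partial>P) \<le> ennreal (u + v * p)"
proof -
  interpret prob_space P by fact
  have "(\<integral>\<^sup>+x. of_nat (f x) \<partial>P) \<le> (\<integral>\<^sup>+x. ennreal u + ennreal v * indicator B x \<partial>P)"
  proof (rule nn_integral_mono)
    fix x assume "x \<in> space P"
    then show "of_nat (f x) \<le> ennreal u + ennreal v * indicator B x"
      using assms(6)[of x] assms(7)[of x] assms(3,4)
      by (cases "x \<in> B") (auto simp: ennreal_of_nat_eq_real_of_nat ennreal_leI add_increasing)
  qed
  also have "\<dots> = ennreal u + ennreal v * emeasure P B"
    using assms(2) by (simp add: nn_integral_add nn_integral_cmult_indicator emeasure_space_1)
  also have "\<dots> \<le> ennreal u + ennreal v * ennreal p"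
    by (intro add_left_mono mult_left_mono assms) simp
  also have "\<dots> = ennreal (u + v * p)"
    using assms by (simp add: ennreal_mult[symmetric] ennreal_plus[symmetric] del: ennreal_plus)
  finally show ?thesis .
qed

text \<open>Multiplying the optimal weights by \<open>Tst l\<close> normalises the optimal value to
  1, by homogeneity of \<open>G\<close>.\<close>

lemma (in bandit) optimal_cost:
  assumes l: "valid l" and j: "j < n"
  shows "0 < Wst l j * Tst l"
    and "j \<noteq> k \<Longrightarrow> 1 \<le> G (Wst l k * Tst l) (Wst l j * Tst l) (l k) (l j)"
proof -
  note W = wstar_maximises[OF l]
  have T: "0 < Tst l" "Tst l * Tinv l = 1" using Tinv_pos[OF l] by (auto simp: Tst_eq)
  show "0 < Wst l j * Tst l" using maximiser_pos[OF l W j] T by simp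
  assume "j \<noteq> k"
  then have "Tst l * Tinv l \<le> Tst l * G (Wst l k) (Wst l j) (l k) (l j)"
    using maximiser_G_ge[OF l W j] T(1) by (intro mult_left_mono) auto
  also have "\<dots> = G (Tst l * Wst l k) (Tst l * Wst l j) (l k) (l j)"
    using T by (subst G_scale) auto
  finally show "1 \<le> G (Wst l k * Tst l) (Wst l j * Tst l) (l k) (l j)"
    using T(2) by (simp add: mult.commute)
qed

text \<open>The limit bound with a slack \<open>\<eta>0\<close>. The constants are fixed before
  \<delta>, in the order \<kappa>, \<open>v\<close>, \<open>h\<close>, \<eta>, \<open>e\<close>,
  \<xi>.\<close>

lemma expected_pulls_limsup:
  fixes \<rho> :: "real measure" and \<Theta> :: "real set" and n :: nat
    and \<mu> :: "nat \<Rightarrow> real" and \<alpha> \<eta>0 :: real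
  assumes "bandit \<rho> \<Theta> n" and \<mu>: "valid_inst \<rho> \<Theta> n 0 \<mu>" and \<alpha>: "1 < \<alpha>" and \<eta>0: "0 < \<eta>0"
  shows "Limsup (at_right 0)
           (\<lambda>\<delta>. enn2ereal (\<integral>\<^sup>+ X. of_nat (tribbai_pulls \<rho> \<Theta> n \<delta>
                      (1 / ln (ln (1 / \<delta>)))
                      (sqrt (ln (1 / \<delta>)))
                      (ln (1 / \<delta>) * ln (ln (1 / \<delta>)) / real n)
                      ((ln (1 / \<delta>))\<^sup>2)
                      \<alpha>
                      (\<lambda>t d. ln (ln (1 / d) * t powr \<alpha> / d))
                      X) \<partial>sample_space \<rho> \<Theta> n \<mu>)
                 / ereal (ln (1 / \<delta>)))
         \<le> ereal (\<alpha> * (Tstar \<rho> \<Theta> n 0 \<mu> + real n * \<eta>0))"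
proof -
  interpret bandit \<rho> \<Theta> n 0 by fact
  have n0: "0 < n" using n2 by simp
  let ?\<beta> = "\<lambda>t d. ln (ln (1 / d) * t powr \<alpha> / d)"
  define P where "P = sample_space \<rho> \<Theta> n \<mu>"
  define c where "c i = Wst \<mu> i * Tst \<mu>" for i
  have cpos: "0 < c i" if "i < n" for i unfolding c_def by (rule optimal_cost(1)[OF \<mu> that])
  have \<mu>M: "\<forall>i<n. \<mu> i \<in> M" using valid_in[OF \<mu>] by blast
  \<comment> \<open>Half of the room between 1 and \<alpha>: the threshold may reach
    \<open>(1 + \<kappa>) * L = \<alpha> * v * L\<close>, and \<open>v < 1\<close> lies strictly
    below the normalised two-arm costs.\<close>
  define \<kappa> where "\<kappa> = (\<alpha> - 1) / 2"
  define v where "v = (1 + \<kappa>) / \<alpha>"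
  have \<kappa>: "0 < \<kappa>" and v: "v < 1" "\<alpha> * v = 1 + \<kappa>"
    using \<alpha> by (auto simp: \<kappa>_def v_def field_simps)
  have "\<forall>j\<in>{0<..<n}. \<exists>h>0. \<forall>\<eta> x z. \<bar>\<eta>\<bar> < h \<longrightarrow> \<bar>x - \<mu> 0\<bar> < h \<longrightarrow> \<bar>z - \<mu> j\<bar> < h \<longrightarrow>
      v < G (c 0 - \<eta>) (c j - \<eta>) x z"
  proof
    fix j assume "j \<in> {0<..<n}"
    then have j: "j < n" "j \<noteq> 0" by auto
    have "v < G (c 0) (c j) (\<mu> 0) (\<mu> j)"
      using optimal_cost(2)[OF \<mu> j] v(1) by (simp add: c_def)
    from G_perturb[OF cpos[OF n0] cpos[OF j(1)] _ _ this]
    show "\<exists>h>0. \<forall>\<eta> x z. \<bar>\<eta>\<bar> < h \<longrightarrow> \<bar>x - \<mu> 0\<bar> < h \<longrightarrow> \<bar>z - \<mu> j\<bar> < h \<longrightarrow>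
      v < G (c 0 - \<eta>) (c j - \<eta>) x z"
      using \<mu>M n0 j by metis
  qed
  from bchoice[OF this] obtain h' where h': "\<And>j. j \<in> {0<..<n} \<Longrightarrow> 0 < h' j"
    "\<And>j \<eta> x z. j \<in> {0<..<n} \<Longrightarrow> \<bar>\<eta>\<bar> < h' j \<Longrightarrow> \<bar>x - \<mu> 0\<bar> < h' j \<Longrightarrow> \<bar>z - \<mu> j\<bar> < h' j \<Longrightarrow>
      v < G (c 0 - \<eta>) (c j - \<eta>) x z"
    by blast
  \<comment> \<open>At most every radius \<open>h' j\<close> and every cost, so that costs reduced
    by \<eta> < h stay positive.\<close>
  define h where "h = Min (insert 1 (h' ` {0<..<n} \<union> c ` {..<n}))"
  have h: "0 < h" unfolding h_def using h'(1) cpos by (subst Min_gr_iff) auto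
  have hh: "h \<le> h' j" if "j \<in> {0<..<n}" for j unfolding h_def using that by (intro Min_le) auto
  have hc: "h \<le> c i" if "i < n" for i unfolding h_def using that by (intro Min_le) auto
  define \<eta> where "\<eta> = min \<eta>0 (h / 2)"
  have \<eta>: "0 < \<eta>" "\<eta> < h" "\<eta> \<le> \<eta>0" using h \<eta>0 by (auto simp: \<eta>_def min_def)
  obtain e where e: "e > 0" "\<And>l'. (\<And>i. i < n \<Longrightarrow> \<bar>l' i - \<mu> i\<bar> < e) \<Longrightarrow>
      valid l' \<and> (\<forall>i<n. \<bar>Wst l' i * Tst l' - Wst \<mu> i * Tst \<mu>\<bar> < \<eta>)"
    using allocation_continuous[OF \<mu> \<eta>(1)] by blast
  \<comment> \<open>One half of \<open>e\<close> goes to the empirical error, the other to the shift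
    \<open>1 / ln L\<close>.\<close>
  define \<xi> where "\<xi> = min (e / 2) h"
  have \<xi>: "0 < \<xi>" "\<xi> \<le> h" "\<xi> \<le> e / 2" using e(1) h by (auto simp: \<xi>_def)
  obtain C r where C: "0 \<le> C" "0 < r" "r < 1"
    "\<And>m0. space P - good n \<mu> \<xi> m0 \<in> sets P"
    "\<And>m0. 0 < m0 \<Longrightarrow> emeasure P (space P - good n \<mu> \<xi> m0) \<le> ennreal (C * r ^ m0)"
    using bad_event_prob[OF \<mu>M \<xi>(1)] unfolding P_def by blast
  define a where "a = \<alpha> * (Tst \<mu> + real n * \<eta>)"
  have Tpos: "0 < Tst \<mu>" using Tinv_pos[OF \<mu>] by (simp add: Tst_eq)
  have a: "0 < a" unfolding a_def using \<alpha> Tpos \<eta> n0 by (intro mult_pos_pos add_pos_pos) auto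
  \<comment> \<open>The total \<open>a * L + n\<close> is at most \<open>K * L\<close> once
    \<open>L > 1\<close>, which makes the threshold bound a function of \<open>L\<close>
    alone.\<close>
  define K where "K = a + real n"
  have K: "0 < K" using a by (simp add: K_def)
  define p where "p = - ln r"
  have p: "0 < p" using C by (simp add: p_def)
  \<comment> \<open>Pulls on the good event plus worst-case pulls times failure probability, per
    unit of \<open>L\<close>.\<close>
  define bnd where "bnd L = (a * L + real n + real n * (sqrt L + L * ln L / real n + L\<^sup>2 + 2)
      * (C * exp (- p * sqrt L))) / L" for L
  define I where "I \<delta> = (\<integral>\<^sup>+ X. of_nat (tribbai_pulls \<rho> \<Theta> n \<delta> (1 / ln (ln (1 / \<delta>)))
      (sqrt (ln (1 / \<delta>))) (ln (1 / \<delta>) * ln (ln (1 / \<delta>)) / real n) ((ln (1 / \<delta>))\<^sup>2) \<alpha> ?\<beta> X) \<partial>P)" for \<delta>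
  \<comment> \<open>Respectively: the shift fits into \<open>e / 2\<close>, the cap
    \<open>L2\<close> exceeds the lower targets, Stage I stays below the upper targets, and the
    threshold is at most \<open>(1 + \<kappa>) * L\<close>.\<close>
  have large: "\<forall>\<^sub>F L in at_top. 1 < L \<and> 1 / ln L \<le> e / 2 \<and> 0 < ln L \<and>
      (\<forall>i\<in>{..<n}. real n * (\<alpha> * (c i - \<eta>)) \<le> ln L) \<and>
      (\<forall>i\<in>{..<n}. sqrt L \<le> \<alpha> * (c i + \<eta>) * L) \<and>
      ln (ln 2 + L) + \<alpha> * (ln K + ln L) + ln 2 + L \<le> (1 + \<kappa>) * L"
  proof (intro eventually_conj eventually_ball_finite ballI threshold_eventually[OF \<kappa>])
    show "\<forall>\<^sub>F L in at_top. 1 / ln L \<le> e / 2"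
      using e(1) by real_asymp
    show "\<forall>\<^sub>F L :: real in at_top. 0 < ln L" by real_asymp
    show "\<forall>\<^sub>F L in at_top. real n * (\<alpha> * (c i - \<eta>)) \<le> ln L" for i
      using ln_at_top by (auto simp: filterlim_at_top)
    show "\<forall>\<^sub>F L in at_top. sqrt L \<le> \<alpha> * (c i + \<eta>) * L" if "i \<in> {..<n}" for i
    proof -
      have "0 < \<alpha> * (c i + \<eta>)"
        using cpos[of i] that \<alpha> \<eta> by (intro mult_pos_pos add_pos_pos) auto
      then show ?thesis by real_asymp
    qed
  qed (auto simp: eventually_gt_at_top)
  have "\<forall>\<^sub>F \<delta> in at_right 0. enn2ereal (I \<delta>) / ereal (ln (1 / \<delta>)) \<le> ereal (bnd (ln (1 / \<delta>)))"
    using eventually_compose_filterlim[OF large filterlim_ln_inverse_at_right] eventually_at_right_less[of 0]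
  proof eventually_elim
    case (elim \<delta>)
    define L where "L = ln (1 / \<delta>)"
    have L: "1 < L" "1 / ln L \<le> e / 2" "0 < ln L"
      "\<And>i. i < n \<Longrightarrow> real n * (\<alpha> * (c i - \<eta>)) \<le> ln L"
      "\<And>i. i < n \<Longrightarrow> sqrt L \<le> \<alpha> * (c i + \<eta>) * L"
      "ln (ln 2 + L) + \<alpha> * (ln K + ln L) + ln 2 + L \<le> (1 + \<kappa>) * L" and \<delta>: "0 < \<delta>"
      using elim unfolding L_def by auto
    define L1 where "L1 = sqrt L"
    define L2 where "L2 = L * ln L / real n"
    have L1: "0 < L1" using L(1) by (simp add: L1_def)
    define m0 where "m0 = nat \<lceil>L1\<rceil>"
    have m0: "0 < m0" "L1 \<le> real m0" unfolding m0_def using L1 by linarith+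
    define u where "u = a * L + real n"
    have goodb: "real (tribbai_pulls \<rho> \<Theta> n \<delta> (1 / ln L) L1 L2 (L\<^sup>2) \<alpha> ?\<beta> X) \<le> u"
      if X: "X \<in> good n \<mu> \<xi> m0" for X
    proof -
      interpret R: good_run \<rho> \<Theta> n \<mu> \<eta> e \<xi> "1 / ln L" \<alpha> \<delta> L1 L2 X
      proof (unfold_locales, unfold L_def[symmetric] c_def[symmetric])
        show "\<And>l. (\<And>i. i < n \<Longrightarrow> \<bar>l i - \<mu> i\<bar> < e) \<Longrightarrow>
          valid l \<and> (\<forall>i<n. \<bar>Wst l i * Tst l - c i\<bar> < \<eta>)" using e(2) by (simp add: c_def)
        show "X \<in> good n \<mu> \<xi> (nat \<lceil>L1\<rceil>)" using X by (simp add: m0_def)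
        show "0 < 1 / ln L" using L by simp
        show "\<xi> + 1 / ln L \<le> e" using L(2) \<xi>(3) by simp
        show "0 < \<alpha>" using \<alpha> by simp
        show "0 < L" using L by simp
        show "0 < L1" by fact
        show "\<alpha> * (c i - \<eta>) * L \<le> L2" if "i < n" for i
        proof -
          have "L * (real n * (\<alpha> * (c i - \<eta>))) \<le> L * ln L"
            using L(4)[OF that] L(1) by (intro mult_left_mono) auto
          then show ?thesis using n0 by (simp add: L2_def field_simps)
        qed
        show "L1 \<le> \<alpha> * (c i + \<eta>) * L" if "i < n" for i
          using L(5)[OF that] by (simp add: L1_def)
      qed
      have tau: "real (\<Sum>i<n. R.N i) \<le> u"
        using R.sum_N_le[OF \<mu>] by (simp add: u_def a_def L_def)
      have tau0: "0 < real (\<Sum>i<n. R.N i)"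
      proof -
        have "0 < R.N 0" using R.N_ge_L1[OF n0] L1 by linarith
        then have "0 < (\<Sum>i<n. R.N i)" using n0 member_le_sum[of 0 "{..<n}" R.N] by simp
        then show ?thesis by (simp only: of_nat_0_less_iff)
      qed
      have "real (\<Sum>i<n. R.N i) \<le> K * L"
      proof -
        have "real n * 1 \<le> real n * L" using L(1) by (intro mult_left_mono) auto
        then show ?thesis using tau by (simp add: u_def K_def algebra_simps)
      qed
      then have "ln (real (\<Sum>i<n. R.N i)) \<le> ln (K * L)"
        using tau0 K L(1) by (subst ln_le_cancel_iff) auto
      also have "\<dots> = ln K + ln L" using K L(1) by (simp add: ln_mult)
      finally have "\<alpha> * ln (real (\<Sum>i<n. R.N i)) \<le> \<alpha> * (ln K + ln L)" using \<alpha> by simp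
      then have thr: "?\<beta> (real (\<Sum>i<n. R.N i)) (\<delta> / 2) \<le> \<alpha> * ln (1 / \<delta>) * v"
        using threshold_eq[OF \<delta> tau0, of \<alpha>] L(1,6) v(2) unfolding L_def[symmetric]
        by (simp add: mult_ac)
      have "tribbai_pulls \<rho> \<Theta> n \<delta> (1 / ln L) L1 L2 (L\<^sup>2) \<alpha> ?\<beta> X = (\<Sum>i<n. R.N i)"
      proof (rule R.stage3_stops[where \<beta> = ?\<beta> and v = v, OF _ _ thr])
        show "\<eta> < Wst \<mu> i * Tst \<mu>" if "i < n" for i
          using hc[OF that] \<eta>(2) by (simp add: c_def)
        fix j assume j: "0 < j" "j < n"
        have "\<bar>empmean X R.N i - \<mu> i\<bar> < h" if "i < n" for i
          using R.empmean_near[of i R.N, OF that R.N_ge_L1[OF that]] \<xi>(2) by simp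
        then show "v \<le> G (Wst \<mu> 0 * Tst \<mu> - \<eta>) (Wst \<mu> j * Tst \<mu> - \<eta>) (empmean X R.N 0) (empmean X R.N j)"
          using h'(2)[of j \<eta> "empmean X R.N 0" "empmean X R.N j"] hh[of j] j n0 \<eta>
          unfolding c_def by force
      qed
      then show ?thesis using tau by simp
    qed
    define w where "w = real n * (L1 + L2 + L\<^sup>2 + 2)"
    have L2: "0 \<le> L2" using L by (simp add: L2_def)
    have "I \<delta> \<le> ennreal (u + w * (C * r ^ m0))"
      unfolding I_def L_def[symmetric] L1_def[symmetric] L2_def[symmetric]
    proof (rule nn_integral_le_good_bad[OF _ C(4)[of m0] _ _ _ _ _ C(5)[OF m0(1)]])
      show "prob_space P" unfolding P_def by (rule prob_space_sample[OF \<mu>M])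
      show "0 \<le> u" using a L(1) by (simp add: u_def)
      show "0 \<le> w" using L1 L2 by (simp add: w_def)
      show "0 \<le> C * r ^ m0" using C by simp
      show "real (tribbai_pulls \<rho> \<Theta> n \<delta> (1 / ln L) L1 L2 (L\<^sup>2) \<alpha> ?\<beta> X) \<le> w" for X
        unfolding w_def by (rule pulls_le) (use L1 L2 in auto)
      show "real (tribbai_pulls \<rho> \<Theta> n \<delta> (1 / ln L) L1 L2 (L\<^sup>2) \<alpha> ?\<beta> X) \<le> u"
        if "X \<in> space P" "X \<notin> space P - good n \<mu> \<xi> m0" for X
        by (rule goodb) (use that in auto)
    qed
    also have "\<dots> \<le> ennreal (u + w * (C * exp (- p * sqrt L)))"
    proof (intro ennreal_leI add_left_mono mult_left_mono)
      have "r ^ m0 = exp (- p * real m0)"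
        using C(2) exp_of_nat_mult[of m0 "ln r"] by (simp add: p_def mult.commute)
      also have "\<dots> \<le> exp (- p * sqrt L)" using m0(2) p by (simp add: L1_def)
      finally show "r ^ m0 \<le> exp (- p * sqrt L)" .
    qed (use C L1 L2 in \<open>auto simp: w_def\<close>)
    finally have "enn2ereal (I \<delta>) \<le> enn2ereal (ennreal (u + w * (C * exp (- p * sqrt L))))"
      by (simp add: less_eq_ennreal.rep_eq)
    also have "\<dots> = ereal (u + w * (C * exp (- p * sqrt L)))"
      using a L(1) L1 L2 C by (intro enn2ereal_ennreal) (auto simp: u_def w_def)
    finally have "enn2ereal (I \<delta>) / ereal L \<le> ereal (u + w * (C * exp (- p * sqrt L))) / ereal L"
      using L(1) by (intro ereal_divide_right_mono) auto
    then show ?case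
      using L(1) unfolding L_def[symmetric] bnd_def u_def w_def L1_def L2_def by simp
  qed
  then have "Limsup (at_right 0) (\<lambda>\<delta>. enn2ereal (I \<delta>) / ereal (ln (1 / \<delta>)))
      \<le> Limsup (at_right 0) (\<lambda>\<delta>. ereal (bnd (ln (1 / \<delta>))))"
    by (rule Limsup_mono)
  also have "\<dots> = ereal a"
  proof (rule lim_imp_Limsup)
    have "(bnd \<longlongrightarrow> a) at_top"
      unfolding bnd_def by (rule failure_cost_vanishes[OF p]) (use n0 in simp)
    then show "((\<lambda>\<delta>. ereal (bnd (ln (1 / \<delta>)))) \<longlongrightarrow> ereal a) (at_right 0)"
      by (intro tendsto_ereal filterlim_compose[OF _ filterlim_ln_inverse_at_right])
  qed (simp add: trivial_limit_at_right_real)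
  also have "\<dots> \<le> ereal (\<alpha> * (Tst \<mu> + real n * \<eta>0))"
    using \<alpha> \<eta>(3) by (simp add: a_def mult_left_mono)
  finally show ?thesis unfolding I_def P_def .
qed

theorem mainTheorem1:
  fixes \<rho> :: "real measure" and \<Theta> :: "real set" and n :: nat
    and \<mu> :: "nat \<Rightarrow> real" and \<alpha> :: real
  assumes fam: "expfam \<rho> \<Theta>"
    and n2: "n \<ge> 2"
    and inst: "\<forall>i<n. \<mu> i \<in> meanset \<rho> \<Theta>"
    and best: "\<forall>i. 1 \<le> i \<and> i < n \<longrightarrow> \<mu> 0 > \<mu> i"
    and sorted: "\<forall>i j. 1 \<le> i \<and> i \<le> j \<and> j < n \<longrightarrow> \<mu> j \<le> \<mu> i"
    and alpha: "1 < \<alpha>" "\<alpha> \<le> exp 1 / 2"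
  shows "Limsup (at_right 0)
           (\<lambda>\<delta>. enn2ereal (\<integral>\<^sup>+ X. of_nat (tribbai_pulls \<rho> \<Theta> n \<delta>
                      (1 / ln (ln (1 / \<delta>)))
                      (sqrt (ln (1 / \<delta>)))
                      (ln (1 / \<delta>) * ln (ln (1 / \<delta>)) / real n)
                      ((ln (1 / \<delta>))\<^sup>2)
                      \<alpha>
                      (\<lambda>t d. ln (ln (1 / d) * t powr \<alpha> / d))
                      X) \<partial>sample_space \<rho> \<Theta> n \<mu>)
                 / ereal (ln (1 / \<delta>)))
         \<le> ereal (\<alpha> * Tstar \<rho> \<Theta> n 0 \<mu>)"
  (is "?lhs \<le> _")
proof (rule ereal_le_epsilon2)
  fix \<epsilon> :: real assume "0 < \<epsilon>"
  \<comment> \<open>Chosen so that the slack \<open>\<alpha> * n * \<eta>\<close> equals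
    \<epsilon>.\<close>
  define \<eta> where "\<eta> = \<epsilon> / (\<alpha> * real n)"
  have "0 < \<eta>" using \<open>0 < \<epsilon>\<close> alpha n2 by (simp add: \<eta>_def)
  have "bandit \<rho> \<Theta> n" using fam n2 by unfold_locales
  moreover have "valid_inst \<rho> \<Theta> n 0 \<mu>" using inst best n2 by (auto simp: valid_inst_def)
  ultimately have "?lhs \<le> ereal (\<alpha> * (Tstar \<rho> \<Theta> n 0 \<mu> + real n * \<eta>))"
    using alpha(1) \<open>0 < \<eta>\<close> by (rule expected_pulls_limsup)
  also have "\<alpha> * (Tstar \<rho> \<Theta> n 0 \<mu> + real n * \<eta>) = \<alpha> * Tstar \<rho> \<Theta> n 0 \<mu> + \<epsilon>"
    using alpha n2 by (simp add: \<eta>_def field_simps)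
  finally show "?lhs \<le> ereal (\<alpha> * Tstar \<rho> \<Theta> n 0 \<mu>) + ereal \<epsilon>" by simp
qed

end
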